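(* Let $$\Delta^{\mathbb{Z}}(\tau):=\frac{\eta(2\tau)^{24}}{\eta(\tau)^{24}},\qquad \Delta^{\mathbb{Z}_4}(\tau):=\frac{\eta(2\tau)^{8}}{\eta(\tau)^{16}}\qquad(\tau\in\mathbb{H}).$$ Let $\tau$ be a field with values in the upper half-plane $\mathbb{H}$ along a closed loop $\gamma$, defined up to $\Gamma_0(2)$ transition functions, and define $$\mathcal{Q}^{\mathbb{Z}}_\gamma:=\frac{1}{2\pi\mathsf{i}}\oint_\gamma dx^\mu\frac{d}{dx^\mu}\log\Delta^{\mathbb{Z}}(\tau(x)),\qquad \mathcal{Q}^{\mathbb{Z}_4}_\gamma:=\frac{1}{2\pi\mathsf{i}}\oint_\gamma dx^\mu\frac{d}{dx^\mu}\log\Delta^{\mathbb{Z}_4}(\tau(x)).$$ (i) One has $\log\Delta^{\mathbb{Z}}(\mathsf{T}\cdot\tau)=\log\Delta^{\mathbb{Z}}(\tau)+2\pi\mathsf{i}$ and $\log\Delta^{\mathbb{Z}}(\mathsf{X}\cdot\tau)=\log\Delta^{\mathbb{Z}}(\tau)$. Therefore the one-form $dx^\mu\frac{d}{dx^\mu}\log\Delta^{\mathbb{Z}}(\tau(x))$ is globally well-defined, and $\mathcal{Q}^{\mathbb{Z}}_\gamma$ is well-defined. (ii) One has $\log\Delta^{\mathbb{Z}_4}(\mathsf{T}\cdot\tau)=\log\Delta^{\mathbb{Z}_4}(\tau)$ and $\log\Delta^{\mathbb{Z}_4}(\mathsf{X}\cdot\tau)=\log\Delta^{\mathbb{Z}_4}(\tau)+2\pi\mathsf{i}-4\log(2\tau-1)$.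 Therefore the one-form $dx^\mu\frac{d}{dx^\mu}\log\Delta^{\mathbb{Z}_4}(\tau(x))$ is not globally well-defined, and the precise expression for $\mathcal{Q}^{\mathbb{Z}_4}_\gamma$ is as follows. Divide $\gamma$ into segments $\gamma_1\cup\cdots\cup\gamma_n$, where $\gamma_i$ is a path from $x_{i-1}$ to $x_i$ and $x_n=x_0$, write $\tau_i:=\tau|_{\gamma_i}$, and let the transition function from $\gamma_i$ to $\gamma_{i+1}$ be $\tau_{i+1}(x_i)=\mathsf{M}_i\cdot\tau_i(x_i)$ with $\mathsf{M}_i=\begin{pmatrix}a_i&b_i\\c_i&d_i\end{pmatrix}\in\Gamma_0(2)$. Then $$\mathcal{Q}^{\mathbb{Z}_4}_\gamma=\frac{1}{2\pi\mathsf{i}}\sum_{i=1}^n\left[\int_{\gamma_i}dx^\mu\frac{d}{dx^\mu}\log\Delta^{\mathbb{Z}_4}(\tau_i(x))+4F(\tau_i(x_i),\mathsf{M}_i)\right],\qquad F(\tau_i,\mathsf{M}_i):=\log(c_i\tau_i+d_i),$$ and $\mathcal{Q}^{\mathbb{Z}_4}_\gamma$ is well-defined modulo $4$. (iii) Writing $\mathcal{Q}_\gamma(\mathsf{M})$ for the value of a charge when the monodromy along $\gamma$ is $\mathsf{M}$, $$\mathcal{Q}^{\mathbb{Z}}_\gamma(\mathsf{T})=1,\quad \mathcal{Q}^{\mathbb{Z}}_\gamma(\mathsf{X})=0,\qquad \mathcal{Q}^{\mathbb{Z}_4}_\gamma(\mathsf{T})=0,\quad \mathcal{Q}^{\mathbb{Z}_4}_\gamma(\mathsf{X})=1\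 (\mathrm{mod}\ 4).$$ Thus these are the two universal charge operators $\mathcal{Q}^{\mathbb{Z}}_\gamma:\Gamma_0(2)\to\mathbb{Z}$ and $\mathcal{Q}^{\mathbb{Z}_4}_\gamma:\Gamma_0(2)\to\mathbb{Z}_4$ associated with $\Gamma_0(2)^{\mathrm{ab}}\cong\mathbb{Z}\times\mathbb{Z}_4$.
   Context: $\eta$ is the Dedekind eta function. $\mathrm{SL}(2,\mathbb{Z})$ acts on $\mathbb{H}$ by $\begin{pmatrix}a&b\\c&d\end{pmatrix}\cdot\tau=\frac{a\tau+b}{c\tau+d}$. $\Gamma_0(2)=\left\{\begin{pmatrix}a&b\\c&d\end{pmatrix}\in\mathrm{SL}(2,\mathbb{Z}) : c\equiv0\bmod 2\right\}$ is generated by $\mathsf{T}=\begin{pmatrix}1&1\\0&1\end{pmatrix}$ and $\mathsf{X}=\begin{pmatrix}1&-1\\2&-1\end{pmatrix}$, with $\mathsf{X}^2=-1$. $G^{\mathrm{ab}}=G/[G,G]$ is the Abelianization. Physically $\tau$ is the axio-dilaton of type 0B string theory on the branch where all fields odd under the left-moving fermion parity vanish; 7-branes enclosed by $\gamma$ have monodromy $\mathsf{M}\in\Gamma_0(2)$ if $\tau\mapsto\mathsf{M}\cdot\tau$ around $\gamma$. A charge is a homomorphism from $\Gamma_0(2)$ to an Abelian group, and universal charges are the components of the Abelianization map, through which every charge factors. The segments are read cyclically, so $\gamma_{n+1}$ means $\gamma_1$.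
   Formalization: In (ii) the term +4F(τ_i(x_i),M_i) is replaced by −4F(τ_i(x_i),M_i): with τ_{i+1}(x_i)=M_i·τ_i(x_i) the plus sign doubles the log(c_iτ_i+d_i) term instead of cancelling it, so the charge would not be an integer or well-defined modulo 4. *)

theory Defs
  imports "HOL-Analysis.Analysis" "HOL-Algebra.Elementary_Groups" "HOL-Algebra.Generated_Groups"
begin

subsection \<open>The congruence subgroup and its action on the upper half-plane\<close>

abbreviation upper_half_plane :: "complex set"
  where "upper_half_plane \<equiv> {\<tau>. Im \<tau> > 0}"

definition Gamma0_2 :: "(int^2^2) monoid"
  where "Gamma0_2 = \<lparr>carrier = {A. det A = 1 \<and> A$2$1 mod 2 = 0}, monoid.mult = (**), one = mat 1\<rparr>"

definition T_mat :: "int^2^2"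
  where "T_mat = vector [vector [1, 1], vector [0, 1]]"

definition X_mat :: "int^2^2"
  where "X_mat = vector [vector [1, -1], vector [2, -1]]"

definition moebius_act :: "int^2^2 \<Rightarrow> complex \<Rightarrow> complex"
  where "moebius_act A \<tau> = (of_int (A$1$1) * \<tau> + of_int (A$1$2)) / (of_int (A$2$1) * \<tau> + of_int (A$2$2))"

text \<open>The automorphy factor \<open>c \<tau> + d\<close>.\<close>

definition autom :: "int^2^2 \<Rightarrow> complex \<Rightarrow> complex"
  where "autom A \<tau> = of_int (A$2$1) * \<tau> + of_int (A$2$2)"


subsection \<open>Eta quotients and their logarithms\<close>

definition dedekind_eta :: "complex \<Rightarrow> complex"
  where "dedekind_eta \<tau> =
    exp (2 * of_real pi * \<i> * \<tau> / 24) * (\<Prod>n. 1 - exp (2 * of_real pi * \<i> * of_nat (Suc n) * \<tau>))"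

definition Delta_Z :: "complex \<Rightarrow> complex"
  where "Delta_Z \<tau> = dedekind_eta (2 * \<tau>) ^ 24 / dedekind_eta \<tau> ^ 24"

definition Delta_Z4 :: "complex \<Rightarrow> complex"
  where "Delta_Z4 \<tau> = dedekind_eta (2 * \<tau>) ^ 8 / dedekind_eta \<tau> ^ 16"

text \<open>\<open>log \<Delta>\<close> is a holomorphic branch of the logarithm of \<open>\<Delta>\<close> on the whole
  half-plane; it is not \<open>Ln (\<Delta> \<tau>)\<close>, which jumps.\<close>

definition log_branch :: "(complex \<Rightarrow> complex) \<Rightarrow> (complex \<Rightarrow> complex) \<Rightarrow> bool"
  where "log_branch f L \<longleftrightarrow>
    L holomorphic_on upper_half_plane \<and> (\<forall>\<tau>\<in>upper_half_plane. exp (L \<tau>) = f \<tau>)"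

text \<open>The one-form \<open>dx\<^sup>\<mu> d/dx\<^sup>\<mu> L (\<tau> (x))\<close>: at each point \<open>x\<close> a linear form on
  tangent vectors.\<close>

definition dlog :: "(complex \<Rightarrow> complex) \<Rightarrow> ('a::real_normed_vector \<Rightarrow> complex) \<Rightarrow> 'a \<Rightarrow> 'a \<Rightarrow> complex"
  where "dlog L \<tau> x = frechet_derivative (\<lambda>y. L (\<tau> y)) (at x)"

text \<open>Since \<open>\<tau>\<close> is only defined up to transition functions, the one-form is globally
  well-defined iff it agrees for any two local representatives of \<open>\<tau>\<close> on a patch \<open>U\<close>.\<close>

definition globally_well_defined :: "(complex \<Rightarrow> complex) \<Rightarrow> ('a::euclidean_space) set \<Rightarrow> bool"
  where "globally_well_defined L U \<longleftrightarrow>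
    (\<forall>M\<in>carrier Gamma0_2. \<forall>\<tau>. \<tau> ` U \<subseteq> upper_half_plane \<and> \<tau> differentiable_on U \<longrightarrow>
       (\<forall>x\<in>U. dlog L (\<lambda>y. moebius_act M (\<tau> y)) x = dlog L \<tau> x))"


subsection \<open>Fields along a closed loop, up to transition functions\<close>

text \<open>The loop is parametrised by \<open>\<real>/\<int>\<close>. The cyclic reading of the \<open>n = nseg\<close> segments
  is implemented by indexing them by all integers, with period \<open>n\<close>: the segment \<open>i\<close> is the
  parameter interval from \<open>cut (i - 1)\<close> to \<open>cut i\<close>, so \<open>cut i\<close> stands for the point \<open>x\<^sub>i\<close>, and
  the segment \<open>i + n\<close> is the segment \<open>i\<close> shifted by one full turn. The function \<open>fld i\<close> of the
  loop parameter is \<open>\<tau>\<^sub>i\<close>, and \<open>trans i\<close> is the transition function \<open>M\<^sub>i\<close> from segment \<open>i\<close> to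
  segment \<open>i + 1\<close>. It is part of the data, because \<open>M\<close> and \<open>- M\<close> act in the same way on
  \<open>\<tau>\<close>.\<close>

record loop_field =
  nseg :: nat
  cut :: "int \<Rightarrow> real"
  fld :: "int \<Rightarrow> real \<Rightarrow> complex"
  trans :: "int \<Rightarrow> int^2^2"

definition segment :: "loop_field \<Rightarrow> int \<Rightarrow> real set"
  where "segment D i = {cut D (i - 1)..cut D i}"

definition is_loop_field :: "loop_field \<Rightarrow> bool"
  where "is_loop_field D \<longleftrightarrow>
    nseg D \<ge> 1 \<and>
    (\<forall>i. cut D (i - 1) < cut D i) \<and>
    (\<forall>i. cut D (i + int (nseg D)) = cut D i + 1) \<and>
    (\<forall>i. \<forall>s\<in>segment D i. fld D (i + int (nseg D)) (s + 1) = fld D i s) \<and>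
    (\<forall>i. trans D (i + int (nseg D)) = trans D i) \<and>
    (\<forall>i. fld D i ` segment D i \<subseteq> upper_half_plane) \<and>
    (\<forall>i. fld D i piecewise_C1_differentiable_on segment D i) \<and>
    (\<forall>i. trans D i \<in> carrier Gamma0_2) \<and>
    (\<forall>i. fld D (i + 1) (cut D i) = moebius_act (trans D i) (fld D i (cut D i)))"

text \<open>Two segmented descriptions represent the same field if they are related by transition
  functions \<open>g i j\<close> (from segment \<open>i\<close> of \<open>D\<close> to segment \<open>j\<close> of \<open>D'\<close>, wherever these meet)
  that are compatible with the transition functions inside \<open>D\<close> and inside \<open>D'\<close>. This covers
  refining or moving the segments, moving the base point \<open>x\<^sub>0\<close>, and replacing each \<open>\<tau>\<^sub>i\<close> by a
  \<open>\<Gamma>\<^sub>0(2)\<close>-image.\<close>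

definition same_field :: "loop_field \<Rightarrow> loop_field \<Rightarrow> bool"
  where "same_field D D' \<longleftrightarrow>
    (\<exists>g :: int \<Rightarrow> int \<Rightarrow> int^2^2.
       (\<forall>i j. segment D i \<inter> segment D' j \<noteq> {} \<longrightarrow>
          g i j \<in> carrier Gamma0_2 \<and>
          g (i + int (nseg D)) (j + int (nseg D')) = g i j \<and>
          (\<forall>s\<in>segment D i \<inter> segment D' j. fld D' j s = moebius_act (g i j) (fld D i s))) \<and>
       (\<forall>i j. cut D i \<in> segment D' j \<longrightarrow> g (i + 1) j ** trans D i = g i j) \<and>
       (\<forall>i j. cut D' j \<in> segment D i \<longrightarrow> trans D' j ** g i j = g i (j + 1)))"

text \<open>Following \<open>\<tau>\<close> continuously from segment 1 onwards, without changing the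
  representative, one finds \<open>continuation D k \<cdot> \<tau>\<^bsub>k+1\<^esub>\<close> on segment \<open>k + 1\<close>. After one turn
  segment \<open>n + 1\<close> is segment 1, so \<open>\<tau> \<mapsto> continuation D n \<cdot> \<tau>\<close> around the loop. The monodromy is
  therefore the inverse of \<open>M\<^sub>n \<cdots> M\<^sub>1\<close>.\<close>

primrec continuation :: "loop_field \<Rightarrow> nat \<Rightarrow> int^2^2"
  where
    "continuation D 0 = mat 1"
  | "continuation D (Suc k) = continuation D k ** inv\<^bsub>Gamma0_2\<^esub> (trans D (int (Suc k)))"

definition monodromy :: "loop_field \<Rightarrow> int^2^2"
  where "monodromy D = continuation D (nseg D)"


subsection \<open>Charges\<close>

definition seg_integral :: "(complex \<Rightarrow> complex) \<Rightarrow> loop_field \<Rightarrow> int \<Rightarrow> complex"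
  where "seg_integral L D i = integral (segment D i) (\<lambda>s. dlog L (fld D i) s 1)"

definition charge_Z :: "(complex \<Rightarrow> complex) \<Rightarrow> loop_field \<Rightarrow> complex"
  where "charge_Z L D = 1 / (2 * of_real pi * \<i>) * (\<Sum>i=1..int (nseg D). seg_integral L D i)"

definition F :: "complex \<Rightarrow> int^2^2 \<Rightarrow> complex"
  where "F \<tau> M = Ln (autom M \<tau>)"

text \<open>\<open>\<phi> i\<close> is a value of the multivalued \<open>log (c\<^sub>i \<tau>\<^sub>i(x\<^sub>i) + d\<^sub>i)\<close>.\<close>

definition log_choice :: "loop_field \<Rightarrow> (int \<Rightarrow> complex) \<Rightarrow> bool"
  where "log_choice D \<phi> \<longleftrightarrow> (\<forall>i. exp (\<phi> i) = autom (trans D i) (fld D i (cut D i)))"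

text \<open>The correction enters with a minus sign. The integrals add up to the sum of
  \<open>L (\<tau>\<^sub>i(x\<^sub>i)) - L (M\<^sub>i \<cdot> \<tau>\<^sub>i(x\<^sub>i))\<close>, and \<open>\<Delta>\<close> has weight \<open>-4\<close>, so each summand is
  \<open>4 log (c\<^sub>i \<tau>\<^sub>i(x\<^sub>i) + d\<^sub>i)\<close> up to a constant. With the transition convention
  \<open>\<tau>\<^bsub>i+1\<^esub>(x\<^sub>i) = M\<^sub>i \<cdot> \<tau>\<^sub>i(x\<^sub>i)\<close> the sign \<open>+4\<close> would double this term instead of cancelling it.
  Equivalently, modulo 4, it is \<open>+4 F\<close> for the inverse transition
  \<open>\<tau>\<^sub>i(x\<^sub>i) = M\<^sub>i\<^sup>-\<^sup>1 \<cdot> \<tau>\<^bsub>i+1\<^esub>(x\<^sub>i)\<close>.\<close>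

definition charge_Z4_with :: "(complex \<Rightarrow> complex) \<Rightarrow> (int \<Rightarrow> complex) \<Rightarrow> loop_field \<Rightarrow> complex"
  where "charge_Z4_with L \<phi> D =
    1 / (2 * of_real pi * \<i>) * (\<Sum>i=1..int (nseg D). seg_integral L D i - 4 * \<phi> i)"

definition charge_Z4 :: "(complex \<Rightarrow> complex) \<Rightarrow> loop_field \<Rightarrow> complex"
  where "charge_Z4 L D = charge_Z4_with L (\<lambda>i. F (fld D i (cut D i)) (trans D i)) D"


subsection \<open>Abelianization\<close>

definition abelianization :: "('g, 'm) monoid_scheme \<Rightarrow> 'g set monoid"
  where "abelianization G = G Mod derived G (carrier G)"

end

(*
  Write Delta = exp (log Delta) with log eta = pi i tau / 12 + sum_n Ln (1 - q^n). The derivative of log eta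
  is, up to constants, the Eisenstein series of weight 2; rearranging its conditionally convergent double
  series gives the transformation of log eta under tau -> -1 / tau, hence those of log Delta^Z and
  log Delta^Z4 under the generators T and X. Along a loop the integrals telescope to the jumps of
  log Delta at the transition points, so each charge is minus the sum of the additive cocycles of the
  transition functions, that is, the value of a character of Gamma_0(2) on the monodromy. The group is
  generated by T and X with X^4 = 1, and the two characters take the values (1, 0) and (0, 1) there, so
  they separate the abelianization.
*)
theory Submission
  imports Defs "HOL-Complex_Analysis.Cauchy_Integral_Formula" "HOL-Number_Theory.Cong"
begin

subsection \<open>The transformation of \<open>log \<eta>\<close> under \<open>\<tau> \<mapsto> - 1 / \<tau>\<close>\<close>

text \<open>The inversion does not lie in \<open>Gamma0_2\<close>, so \<open>X_mat\<close> is
  reached through the Fricke involution, under which inversion acts on \<open>\<tau>\<close> and on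
  \<open>2 * \<tau>\<close>. The only non-modular term, \<open>pi * \<i> / \<tau>\<close>, arises
  when the order of a double sum is exchanged: the correction that makes the sum absolutely
  convergent cancels along rows, but along columns a boundary value survives, the limit of a
  cotangent in the lower half-plane. Integration turns it into
  \<open>Ln (\<tau> / \<i>) / 2\<close>, the weight 1/2 of eta, and the constant of integration is
  fixed at \<open>\<i>\<close>, the fixed point of inversion.

  In (ii) the weight is -4, and a logarithm of \<open>c \<tau> + d\<close> is determined up to
  \<open>2 * pi * \<i>\<close>, so each correction term is determined up to four times that: hence
  charges modulo 4.

  Two signs cancel: a jump contributes minus its cocycle, and the monodromy is the inverse of the
  product of the transition functions. Telescoping settles one segmented description only;
  independence of the description needs a walk through a common refinement.\<close>

lemma Digamma_reflection_complex:
  fixes z :: complex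
  assumes "z \<notin> \<int>"
  shows "Digamma (1 - z) - Digamma z = of_real pi * cot (of_real pi * z)"
proof -
  have z: "z \<notin> \<int>\<^sub>\<le>\<^sub>0" "1 - z \<notin> \<int>\<^sub>\<le>\<^sub>0"
    using assms nonpos_Ints_Int Ints_diff[of 1 "1 - z"] by auto
  have "((\<lambda>z. rGamma z * rGamma (1 - z)) has_field_derivative
      (- rGamma z * Digamma z) * rGamma (1 - z) + rGamma z * (rGamma (1 - z) * Digamma (1 - z))) (at z)"
    using z by (auto intro!: derivative_eq_intros)
  \<comment> \<open>The same derivative computed a second way: by Euler's reflection formula the
    product equals \<open>sin (pi * z) / pi\<close>.\<close>
  moreover have "((\<lambda>z. rGamma z * rGamma (1 - z)) has_field_derivative cos (of_real pi * z)) (at z)"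
    unfolding rGamma_reflection_complex by (auto intro!: derivative_eq_intros)
  ultimately have "(- rGamma z * Digamma z) * rGamma (1 - z) + rGamma z * (rGamma (1 - z) * Digamma (1 - z))
      = cos (of_real pi * z)"
    by (rule DERIV_unique)
  then have "rGamma z * rGamma (1 - z) * (Digamma (1 - z) - Digamma z) = cos (of_real pi * z)"
    by (simp add: algebra_simps)
  moreover have "rGamma z * rGamma (1 - z) \<noteq> 0"
    using z by (simp add: rGamma_eq_zero_iff)
  ultimately show ?thesis
    unfolding rGamma_reflection_complex by (auto simp: cot_def field_simps)
qed

lemma Trigamma_reflection_complex:
  fixes z :: complex
  assumes "z \<notin> \<int>"
  shows "Polygamma 1 (1 - z) + Polygamma 1 z = of_real pi ^ 2 / sin (of_real pi * z) ^ 2"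
proof -
  have z: "z \<notin> \<int>\<^sub>\<le>\<^sub>0" "1 - z \<notin> \<int>\<^sub>\<le>\<^sub>0"
    using assms nonpos_Ints_Int Ints_diff[of 1 "1 - z"] by auto
  have op: "open (- \<int> :: complex set)"
    using closed_Ints by blast
  have nz: "rGamma z * rGamma (1 - z) \<noteq> 0"
    using z by (simp add: rGamma_eq_zero_iff)
  hence s: "sin (of_real pi * z) \<noteq> 0"
    unfolding rGamma_reflection_complex by simp
  have "((\<lambda>z. Digamma (1 - z) - Digamma z) has_field_derivative
          - Polygamma 1 (1 - z) - Polygamma 1 z) (at z)"
    using z by (auto intro!: derivative_eq_intros)
  moreover have "((\<lambda>z::complex. of_real pi * (cos (of_real pi * z) / sin (of_real pi * z)))
      has_field_derivative - (of_real pi ^ 2 / sin (of_real pi * z) ^ 2)) (at z)"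
  proof -
    have "((\<lambda>z::complex. of_real pi * (cos (of_real pi * z) / sin (of_real pi * z)))
      has_field_derivative of_real pi * ((- sin (of_real pi * z) * of_real pi * sin (of_real pi * z)
         - cos (of_real pi * z) * (cos (of_real pi * z) * of_real pi)) /
         (sin (of_real pi * z) * sin (of_real pi * z)))) (at z)"
      using s by (auto intro!: derivative_eq_intros) (simp add: algebra_simps)
    also have "- sin (of_real pi * z) * of_real pi * sin (of_real pi * z)
         - cos (of_real pi * z) * (cos (of_real pi * z) * of_real pi) =
         - of_real pi * (sin (of_real pi * z) ^ 2 + cos (of_real pi * z) ^ 2)"
      by algebra
    finally have "((\<lambda>z::complex. of_real pi * (cos (of_real pi * z) / sin (of_real pi * z))) has_field_derivative
      of_real pi * (- of_real pi * 1 / (sin (of_real pi * z) * sin (of_real pi * z)))) (at z)"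
      unfolding sin_cos_squared_add .
    then show ?thesis by (simp add: power2_eq_square)
  qed
  then have "((\<lambda>z. Digamma (1 - z) - Digamma z) has_field_derivative
      - (of_real pi ^ 2 / sin (of_real pi * z) ^ 2)) (at z)"
    by (rule has_field_derivative_transform_within_open[OF _ op])
       (use assms Digamma_reflection_complex in \<open>auto simp: cot_def\<close>)
  ultimately have "- Polygamma 1 (1 - z) - Polygamma 1 z = - (of_real pi ^ 2 / sin (of_real pi * z) ^ 2)"
    by (rule DERIV_unique)
  then show ?thesis
    by (simp add: algebra_simps)
qed

text \<open>\<open>Polygamma 1\<close> is a series of inverse squares over a half-line; its values
  at \<open>1 + z\<close> and \<open>1 - z\<close> supply the two halves of the integers, and the
  reflection formula sums them. The term at 0 stands on the right.\<close>

lemma sums_inverse_squares_shifted: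
  fixes z :: complex
  assumes "z \<notin> \<int>"
  shows "(\<lambda>n. 1 / (z + of_nat (Suc n)) ^ 2 + 1 / (z - of_nat (Suc n)) ^ 2)
           sums (of_real pi ^ 2 / sin (of_real pi * z) ^ 2 - 1 / z ^ 2)"
proof -
  have nz: "z \<noteq> 0" "1 - z \<noteq> 0" "1 + z \<noteq> 0"
    using assms by (auto simp: add_eq_0_iff)
  have "(\<lambda>k. inverse ((1 + z + of_nat k)^2)) sums (Polygamma 1 (1 + z))"
    using Polygamma_LIMSEQ[of "1 + z" 1] nz by (simp add: numeral_2_eq_2)
  moreover have "(\<lambda>k. inverse ((1 - z + of_nat k)^2)) sums (Polygamma 1 (1 - z))"
    using Polygamma_LIMSEQ[of "1 - z" 1] nz by (simp add: numeral_2_eq_2)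
  ultimately have "(\<lambda>k. inverse ((1 + z + of_nat k)^2) + inverse ((1 - z + of_nat k)^2)) sums
      (Polygamma 1 (1 + z) + Polygamma 1 (1 - z))"
    by (rule sums_add)
  moreover have "Polygamma 1 (1 + z) = Polygamma 1 z - 1 / z ^ 2"
    using Polygamma_plus1[of z 1] nz by (simp add: add.commute power2_eq_square)
  moreover have "(\<lambda>k. inverse ((1 + z + of_nat k)^2) + inverse ((1 - z + of_nat k)^2)) =
      (\<lambda>n. 1 / (z + of_nat (Suc n)) ^ 2 + 1 / (z - of_nat (Suc n)) ^ 2)"
  proof
    fix k :: nat
    have "(1 - z + of_nat k)^2 = (z - of_nat (Suc k)) ^ 2"
      by (simp add: power2_eq_square algebra_simps)
    then show "inverse ((1 + z + of_nat k)^2) + inverse ((1 - z + of_nat k)^2) =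
      1 / (z + of_nat (Suc k)) ^ 2 + 1 / (z - of_nat (Suc k)) ^ 2"
      by (simp add: inverse_eq_divide add_ac)
  qed
  ultimately have "(\<lambda>n. 1 / (z + of_nat (Suc n)) ^ 2 + 1 / (z - of_nat (Suc n)) ^ 2)
      sums (Polygamma 1 z - 1 / z ^ 2 + Polygamma 1 (1 - z))"
    by simp
  also have "Polygamma 1 z - 1 / z ^ 2 + Polygamma 1 (1 - z) =
      of_real pi ^ 2 / sin (of_real pi * z) ^ 2 - 1 / z ^ 2"
    unfolding Trigamma_reflection_complex[OF assms, symmetric] by simp
  finally show ?thesis .
qed

text \<open>Mittag-Leffler expansion of the cotangent, obtained as a difference of two digamma
  series in which the harmonic terms cancel. The corrections in the double sum below lead to series
  of this shape when summed over rows.\<close>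

lemma sums_cot:
  fixes u :: complex
  assumes "u \<notin> \<int>"
  shows "(\<lambda>n. 1 / (of_nat (Suc n) - u) - 1 / (of_nat (Suc n) + u))
           sums (1 / u - of_real pi * cot (of_real pi * u))"
proof -
  have nz: "u \<noteq> 0" "1 - u \<noteq> 0" "1 + u \<noteq> 0"
    using assms by (auto simp: add_eq_0_iff)
  have D: "(\<lambda>n. inverse (of_nat (Suc n)) - inverse (z + of_nat n)) sums (Digamma z + euler_mascheroni)"
    if "z \<noteq> 0" for z :: complex
    using summable_sums[OF summable_Digamma[OF that]] by (simp add: Digamma_def)
  have "(\<lambda>n. (inverse (of_nat (Suc n)) - inverse (1 + u + of_nat n)) -
             (inverse (of_nat (Suc n)) - inverse (1 - u + of_nat n)))
          sums (Digamma (1 + u) + euler_mascheroni - (Digamma (1 - u) + euler_mascheroni))"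
    by (intro sums_diff D nz)
  moreover have "Digamma (1 + u) = Digamma u + 1 / u"
    using Polygamma_plus1[of u 0] nz by (simp add: add.commute)
  ultimately show ?thesis
    using Digamma_reflection_complex[OF assms]
    by (simp add: inverse_eq_divide algebra_simps)
qed

text \<open>Domination by a product of summable sequences gives absolute summability over pairs,
  hence Fubini for \<open>infsum\<close>; the result is translated back to
  \<open>suminf\<close>.\<close>

lemma double_series_swap:
  fixes f :: "nat \<Rightarrow> nat \<Rightarrow> complex"
  assumes a: "summable a" and b: "summable b"
    and ab: "\<And>m n. norm (f m n) \<le> a m * b n" and nonneg: "\<And>m. a m \<ge> 0" "\<And>n. b n \<ge> 0"
  shows "summable (\<lambda>m. \<Sum>n. f m n)" "summable (\<lambda>n. \<Sum>m. f m n)"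
    "(\<Sum>m. \<Sum>n. f m n) = (\<Sum>n. \<Sum>m. f m n)"
proof -
  have A: "a summable_on UNIV" and B: "b summable_on UNIV"
    using a b nonneg by (auto simp: summable_on_UNIV_nonneg_real_iff)
  have row: "(\<lambda>n. norm (f m n)) summable_on UNIV" for m
    by (rule Infinite_Sum.abs_summable_on_comparison_test'[OF summable_on_cmult_right[OF B, of "a m"] ab])
  have "(\<lambda>p. norm (a (fst p) * b (snd p))) summable_on UNIV \<times> UNIV"
    using A B nonneg by (subst Infinite_Sum.abs_summable_on_Sigma_iff)
      (auto simp: abs_mult infsum_cmult_right' intro!: summable_on_cmult_right summable_on_cmult_left)
  then have "(\<lambda>p. a (fst p) * b (snd p)) summable_on UNIV \<times> UNIV"
    by (rule abs_summable_summable)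
  then have "(\<lambda>p. norm (f (fst p) (snd p))) summable_on UNIV \<times> UNIV"
    by (rule Infinite_Sum.abs_summable_on_comparison_test') (rule ab)
  then have S: "(\<lambda>(m, n). f m n) summable_on (UNIV \<times> UNIV)"
    unfolding case_prod_unfold by (rule abs_summable_summable)
  have S': "(\<lambda>(n, m). f m n) summable_on (UNIV \<times> UNIV)"
    using S by (subst summable_on_swap) (simp add: case_prod_unfold o_def)
  have col: "(\<lambda>m. norm (f m n)) summable_on UNIV" for n
    by (rule Infinite_Sum.abs_summable_on_comparison_test'[OF summable_on_cmult_left[OF A, of "b n"] ab])
  have sum_eq: "infsum g UNIV = suminf g" "summable g" if "g summable_on UNIV" for g :: "nat \<Rightarrow> complex"
    using has_sum_imp_sums[OF has_sum_infsum[OF that]] by (auto simp: sums_iff)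
  have r: "infsum (f m) UNIV = suminf (f m)" for m
    by (rule sum_eq[OF abs_summable_summable[OF row]])
  have c: "infsum (\<lambda>m. f m n) UNIV = suminf (\<lambda>m. f m n)" for n
    by (rule sum_eq[OF abs_summable_summable[OF col]])
  have 1: "(\<lambda>m. \<Sum>n. f m n) summable_on UNIV"
    using summable_on_Sigma_banach[OF S] r by simp
  have 2: "(\<lambda>n. \<Sum>m. f m n) summable_on UNIV"
    using summable_on_Sigma_banach[OF S'] c by simp
  show "summable (\<lambda>m. \<Sum>n. f m n)" "summable (\<lambda>n. \<Sum>m. f m n)"
    using sum_eq(2)[OF 1] sum_eq(2)[OF 2] by auto
  show "(\<Sum>m. \<Sum>n. f m n) = (\<Sum>n. \<Sum>m. f m n)"
    using infsum_swap_banach[OF S] r c sum_eq(1)[OF 1] sum_eq(1)[OF 2] by simp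
qed

section \<open>The weight-2 Eisenstein series under inversion\<close>

text \<open>Subtracting the telescoping term \<open>1 / (z\<^sup>2 - 1/4) = 1 / (z - 1/2) - 1 / (z + 1/2)\<close> turns
  the conditionally convergent series of the \<open>1 / (m \<tau> + n)\<^sup>2\<close> into an absolutely convergent one.\<close>

definition eis_term :: "complex \<Rightarrow> complex" where
  "eis_term z = 1 / z ^ 2 - (1 / (z - 1 / 2) - 1 / (z + 1 / 2))"

text \<open>Each summand is the sum of \<open>1 / (Suc m * \<tau> + n)^2\<close> over all integers
  \<open>n\<close>, so the Eisenstein series of weight 2, summed by rows, is
  \<open>pi^2 / 3 + 2 * eis_sum \<tau>\<close>.\<close>

definition eis_sum :: "complex \<Rightarrow> complex" where
  "eis_sum \<tau> = (\<Sum>m. of_real pi ^ 2 / sin (of_real pi * (of_nat (Suc m) * \<tau>)) ^ 2)"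

lemma norm_lattice_ge:
  fixes \<tau> :: complex and m x :: real
  assumes "Im \<tau> > 0" "m \<ge> 0"
  shows "norm (of_real m * \<tau> + of_real x) \<ge> Im \<tau> * m"
    and "norm (of_real m * \<tau> + of_real x) \<ge> Im \<tau> / norm \<tau> * \<bar>x\<bar>"
proof -
  show "norm (of_real m * \<tau> + of_real x) \<ge> Im \<tau> * m"
    using abs_Im_le_cmod[of "of_real m * \<tau> + of_real x"] assms by (simp add: mult.commute)
  \<comment> \<open>Multiplication by \<open>cnj \<tau>\<close> makes the \<open>m\<close> part
    real, so the imaginary part sees \<open>x\<close> alone.\<close>
  have "\<bar>Im ((of_real m * \<tau> + of_real x) * cnj \<tau>)\<bar> \<le> norm (of_real m * \<tau> + of_real x) * norm \<tau>"
    by (metis abs_Im_le_cmod complex_mod_cnj norm_mult)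
  moreover have "\<bar>Im ((of_real m * \<tau> + of_real x) * cnj \<tau>)\<bar> = Im \<tau> * \<bar>x\<bar>"
    using assms by (simp add: algebra_simps abs_mult)
  moreover have "norm \<tau> > 0" using assms by auto
  ultimately show "norm (of_real m * \<tau> + of_real x) \<ge> Im \<tau> / norm \<tau> * \<bar>x\<bar>"
    by (simp add: field_simps)
qed

text \<open>In closed form \<open>eis_term z\<close> is \<open>-1/4\<close> divided by
  \<open>z^2 * (z^2 - 1/4)\<close>. Half of this fourth-order decay is spent on \<open>m\<close> and
  half on \<open>x\<close>, which gives a product of two summable sequences.\<close>

lemma norm_eis_term_le:
  fixes \<tau> :: complex and m x :: real
  assumes \<tau>: "Im \<tau> > 0" and m: "m \<ge> 1" and x: "\<bar>x\<bar> \<ge> 1"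
  shows "norm (eis_term (of_real m * \<tau> + of_real x)) \<le>
           1 / (2 * Im \<tau> ^ 2 * (Im \<tau> / norm \<tau>) ^ 2) * (1 / m\<^sup>2 * (1 / x\<^sup>2))"
proof -
  define z where "z = of_real m * \<tau> + of_real x"
  define \<alpha> where "\<alpha> = Im \<tau>"
  define \<beta> where "\<beta> = Im \<tau> / norm \<tau>"
  have pos: "\<alpha> > 0" "\<beta> > 0" using \<tau> by (auto simp: \<alpha>_def \<beta>_def intro!: divide_pos_pos)
  have y: "norm (z + of_real y) \<ge> \<alpha> * m" "norm (z + of_real y) \<ge> \<beta> * (\<bar>x\<bar> / 2)" if "\<bar>y\<bar> \<le> 1 / 2" for y
  proof -
    have "z + of_real y = of_real m * \<tau> + of_real (x + y)" by (simp add: z_def)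
    then have "norm (z + of_real y) \<ge> \<alpha> * m" "norm (z + of_real y) \<ge> \<beta> * \<bar>x + y\<bar>"
      using norm_lattice_ge[OF \<tau>, of m "x + y"] m unfolding \<alpha>_def \<beta>_def by (simp_all only:)
    \<comment> \<open>A shift by at most 1/2 costs at most half of \<open>\<bar>x\<bar>\<close>,
      which is at least 1.\<close>
    moreover have "\<beta> * (\<bar>x\<bar> / 2) \<le> \<beta> * \<bar>x + y\<bar>"
    proof (rule mult_left_mono)
      show "\<bar>x\<bar> / 2 \<le> \<bar>x + y\<bar>" using that x by linarith
    qed (use pos in simp)
    ultimately show "norm (z + of_real y) \<ge> \<alpha> * m" "norm (z + of_real y) \<ge> \<beta> * (\<bar>x\<bar> / 2)" by linarith+
  qed
  have z0: "norm z \<ge> \<alpha> * m" "norm z \<ge> \<beta> * \<bar>x\<bar>"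
    using norm_lattice_ge[OF \<tau>, of m x] m by (auto simp: z_def \<alpha>_def \<beta>_def)
  have zp: "norm (z + 1/2) \<ge> \<alpha> * m" "norm (z + 1/2) \<ge> \<beta> * (\<bar>x\<bar> / 2)"
    using y[of "1/2"] by simp_all
  have zm: "norm (z - 1/2) \<ge> \<alpha> * m" "norm (z - 1/2) \<ge> \<beta> * (\<bar>x\<bar> / 2)"
    using y[of "-1/2"] by simp_all
  have am: "\<alpha> * m > 0" and bx: "\<beta> * \<bar>x\<bar> > 0" using pos m x by auto
  have nz: "z \<noteq> 0" "z + 1/2 \<noteq> 0" "z - 1/2 \<noteq> 0"
    using z0(1) zp(1) zm(1) am by (metis norm_zero not_le)+
  have "1 / z ^ 2 - (1 / (z - h) - 1 / (z + h)) = (h\<^sup>2 * (-1)) / (z ^ 2 * ((z - h) * (z + h)))"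
    if "z + h \<noteq> 0" "z - h \<noteq> 0" "2 * h = 1" for h
  proof -
    have "1 / (z - h) - 1 / (z + h) = 1 / ((z - h) * (z + h))"
      using that by (simp add: divide_simps)
    moreover have "(z - h) * (z + h) = z\<^sup>2 - h\<^sup>2" by (simp add: power2_eq_square algebra_simps)
    moreover have "1 / z ^ 2 - 1 / A = (A - z\<^sup>2) / (z\<^sup>2 * A)" if "A \<noteq> 0" for A
      using nz(1) that by (simp add: divide_simps)
    moreover have "(z - h) * (z + h) \<noteq> 0" using that by auto
    ultimately show ?thesis by simp
  qed
  from this[of "1/2"] have "eis_term z = - (1 / 4) / (z ^ 2 * ((z - 1/2) * (z + 1/2)))"
    using nz unfolding eis_term_def by (simp add: power2_eq_square)
  then have "norm (eis_term z) = (1 / 4) / (norm z ^ 2 * (norm (z - 1/2) * norm (z + 1/2)))"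
    by (simp add: norm_divide norm_mult norm_power)
  also have "\<dots> \<le> (1 / 4) / (((\<alpha> * m) * (\<beta> * \<bar>x\<bar>)) * ((\<alpha> * m) * (\<beta> * (\<bar>x\<bar> / 2))))"
  proof (intro divide_left_mono mult_mono)
    show "(\<alpha> * m) * (\<beta> * \<bar>x\<bar>) \<le> norm z ^ 2"
      unfolding power2_eq_square by (intro mult_mono z0) (use am bx in auto)
    show "0 < norm z ^ 2 * (norm (z - 1/2) * norm (z + 1/2)) * (((\<alpha> * m) * (\<beta> * \<bar>x\<bar>)) * ((\<alpha> * m) * (\<beta> * (\<bar>x\<bar> / 2))))"
      using pos m x nz by (intro mult_pos_pos) auto
  qed (use am bx zp zm in auto)
  also have "\<dots> = 1 / (2 * \<alpha> ^ 2 * \<beta> ^ 2) * (1 / m\<^sup>2 * (1 / x\<^sup>2))"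
    using abs_mult_self_eq[of x] by (simp add: power2_eq_square divide_simps)
  finally show ?thesis unfolding z_def \<alpha>_def \<beta>_def .
qed

lemma summable_inverse_Suc_squares: "summable (\<lambda>n. 1 / (real (Suc n))\<^sup>2)"
  using sums_summable[OF inverse_squares_sums] by simp

text \<open>Opposite columns are taken together, as in the expansions above; column 0 is left out
  and added back in the inversion formula.\<close>

definition eis_pair :: "complex \<Rightarrow> nat \<Rightarrow> nat \<Rightarrow> complex" where
  "eis_pair \<tau> m n = eis_term (of_nat (Suc m) * \<tau> + of_nat (Suc n)) + eis_term (of_nat (Suc m) * \<tau> - of_nat (Suc n))"

lemma eis_pair_swap:
  assumes \<tau>: "Im \<tau> > 0"
  shows "summable (\<lambda>m. \<Sum>n. eis_pair \<tau> m n)" "summable (\<lambda>n. \<Sum>m. eis_pair \<tau> m n)"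
    "(\<Sum>m. \<Sum>n. eis_pair \<tau> m n) = (\<Sum>n. \<Sum>m. eis_pair \<tau> m n)"
proof -
  define K where "K = 1 / (Im \<tau> ^ 2 * (Im \<tau> / norm \<tau>) ^ 2)"
  have K: "K \<ge> 0" by (simp add: K_def)
  have "norm (eis_pair \<tau> m n) \<le> K * (1 / (real (Suc m))\<^sup>2) * (1 / (real (Suc n))\<^sup>2)" for m n
  proof -
    have "norm (eis_pair \<tau> m n) \<le> norm (eis_term (of_real (real (Suc m)) * \<tau> + of_real (real (Suc n)))) +
        norm (eis_term (of_real (real (Suc m)) * \<tau> + of_real (- real (Suc n))))"
    proof -
      have "of_nat (Suc m) * \<tau> + of_nat (Suc n) = of_real (real (Suc m)) * \<tau> + of_real (real (Suc n))"
        "of_nat (Suc m) * \<tau> - of_nat (Suc n) = of_real (real (Suc m)) * \<tau> + of_real (- real (Suc n))"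
        by simp_all
      then show ?thesis unfolding eis_pair_def by (simp only: norm_triangle_ineq)
    qed
    also have "\<dots> \<le> K / 2 * (1 / (real (Suc m))\<^sup>2 * (1 / (real (Suc n))\<^sup>2)) +
        K / 2 * (1 / (real (Suc m))\<^sup>2 * (1 / (- real (Suc n))\<^sup>2))"
      using norm_eis_term_le[OF \<tau>, of "real (Suc m)" "real (Suc n)"]
        norm_eis_term_le[OF \<tau>, of "real (Suc m)" "- real (Suc n)"]
      by (intro add_mono) (simp_all add: K_def mult.assoc)
    also have "(- real (Suc n))\<^sup>2 = (real (Suc n))\<^sup>2" by (rule power2_minus)
    finally show ?thesis by (simp add: mult.assoc)
  qed
  note * = double_series_swap[where f = "eis_pair \<tau>", OF summable_mult[OF summable_inverse_Suc_squares]
     summable_inverse_Suc_squares this]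
  show "summable (\<lambda>m. \<Sum>n. eis_pair \<tau> m n)" "summable (\<lambda>n. \<Sum>m. eis_pair \<tau> m n)"
    "(\<Sum>m. \<Sum>n. eis_pair \<tau> m n) = (\<Sum>n. \<Sum>m. eis_pair \<tau> m n)"
    using K by (auto intro!: *)
qed

lemma nonreal_not_Int: "Im z \<noteq> 0 \<Longrightarrow> z \<notin> \<int>"
  by (auto elim!: Ints_cases)

lemma tendsto_inverse_shift_nat:
  shows "(\<lambda>n. 1 / (z + of_nat n :: complex)) \<longlonglongrightarrow> 0" "(\<lambda>n. 1 / (z - of_nat n :: complex)) \<longlonglongrightarrow> 0"
proof -
  have 1: "(\<lambda>n. inverse (z + of_nat n)) \<longlonglongrightarrow> 0" for z :: complex
    by (intro filterlim_compose[OF tendsto_inverse_0] tendsto_add_filterlim_at_infinity[OF tendsto_const] tendsto_of_nat)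
  show "(\<lambda>n. 1 / (z + of_nat n :: complex)) \<longlonglongrightarrow> 0" using 1 by (simp add: inverse_eq_divide)
  have "(\<lambda>n. - inverse (-z + of_nat n)) \<longlonglongrightarrow> 0" using tendsto_minus[OF 1[of "-z"]] by simp
  also have "(\<lambda>n. - inverse (-z + of_nat n)) = (\<lambda>n. 1 / (z - of_nat n :: complex))"
    by (metis (no_types, opaque_lifting) add.commute diff_conv_add_uminus inverse_eq_divide inverse_minus_eq minus_diff_eq)
  finally show "(\<lambda>n. 1 / (z - of_nat n :: complex)) \<longlonglongrightarrow> 0" .
qed

text \<open>Over a full row the corrections telescope to zero, so \<open>eis_term\<close> has the
  same row sum as the inverse squares.\<close>

lemma eis_row:
  fixes z :: complex
  assumes "Im z \<noteq> 0"
  shows "(\<lambda>n. eis_term (z + of_nat (Suc n)) + eis_term (z - of_nat (Suc n))) sums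
     (of_real pi ^ 2 / sin (of_real pi * z) ^ 2 - eis_term z)"
proof -
  \<comment> \<open>\<open>P n\<close> is the telescoped sum of the corrections over the columns
    from \<open>- n\<close> to \<open>n\<close>.\<close>
  define P where "P n = 1 / (z - 1/2 - of_nat n) - 1 / (z + 1/2 + of_nat n)" for n :: nat
  have "P \<longlonglongrightarrow> 0 - 0"
    unfolding P_def by (intro tendsto_diff tendsto_inverse_shift_nat)
  then have "(\<lambda>n. P (Suc n) - P n) sums (0 - P 0)"
    by (intro telescope_sums) simp
  from sums_diff[OF sums_inverse_squares_shifted[OF nonreal_not_Int[OF assms]] this]
  have "(\<lambda>n. 1 / (z + of_nat (Suc n)) ^ 2 + 1 / (z - of_nat (Suc n)) ^ 2 - (P (Suc n) - P n)) sums
     (of_real pi ^ 2 / sin (of_real pi * z) ^ 2 - 1 / z ^ 2 - (0 - P 0))" .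
  moreover have "1 / (z + of_nat (Suc n)) ^ 2 + 1 / (z - of_nat (Suc n)) ^ 2 - (P (Suc n) - P n) =
      eis_term (z + of_nat (Suc n)) + eis_term (z - of_nat (Suc n))" for n
  proof -
    have "z + of_nat (Suc n) - 1/2 = z + 1/2 + of_nat n" "z + of_nat (Suc n) + 1/2 = z + 1/2 + of_nat (Suc n)"
      "z - of_nat (Suc n) - 1/2 = z - 1/2 - of_nat (Suc n)" "z - of_nat (Suc n) + 1/2 = z - 1/2 - of_nat n"
      by (simp_all add: field_simps)
    then show ?thesis unfolding eis_term_def P_def by (simp only:) (simp only: algebra_simps)
  qed
  moreover have "1 / z ^ 2 + (0 - P 0) = eis_term z"
    unfolding eis_term_def P_def by simp
  ultimately show ?thesis by (simp add: algebra_simps)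
qed

text \<open>Taking \<open>1 / \<tau>\<close> out of each term leaves the cotangent series at
  \<open>w / \<tau>\<close>. Later \<open>w\<close> is a half-integer, the boundary between two
  neighbouring columns.\<close>

lemma sums_cot_scaled:
  fixes \<tau> :: complex and w :: real
  assumes \<tau>: "Im \<tau> > 0" and w: "w > 0"
  shows "(\<lambda>m. 1 / (of_nat (Suc m) * \<tau> - of_real w) - 1 / (of_nat (Suc m) * \<tau> + of_real w)) sums
      (1 / of_real w - of_real pi / \<tau> * cot (of_real pi * (of_real w / \<tau>)))"
proof -
  have \<tau>0: "\<tau> \<noteq> 0" using \<tau> by auto
  have "Im (of_real w / \<tau>) \<noteq> 0" using \<tau> w by (simp add: Im_divide)
  from sums_mult[OF sums_cot[OF nonreal_not_Int[OF this]], of "1 / \<tau>"]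
  have "(\<lambda>n. 1 / \<tau> * (1 / (of_nat (Suc n) - of_real w / \<tau>) - 1 / (of_nat (Suc n) + of_real w / \<tau>))) sums
     (1 / \<tau> * (1 / (of_real w / \<tau>) - of_real pi * cot (of_real pi * (of_real w / \<tau>))))" .
  moreover have "1 / \<tau> * (1 / (of_nat (Suc n) - of_real w / \<tau>) - 1 / (of_nat (Suc n) + of_real w / \<tau>)) =
     1 / (of_nat (Suc n) * \<tau> - of_real w) - 1 / (of_nat (Suc n) * \<tau> + of_real w)" for n
  proof -
    have "\<tau> * (of_nat (Suc n) - of_real w / \<tau>) = of_nat (Suc n) * \<tau> - of_real w"
      "\<tau> * (of_nat (Suc n) + of_real w / \<tau>) = of_nat (Suc n) * \<tau> + of_real w"
      using \<tau>0 by (simp_all add: field_simps)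
    moreover have "1 / \<tau> * (1 / a - 1 / b) = 1 / (\<tau> * a) - 1 / (\<tau> * b)" for a b
      by (simp add: right_diff_distrib)
    ultimately show ?thesis by simp
  qed
  ultimately show ?thesis using \<tau>0 by (simp add: algebra_simps)
qed

text \<open>Division by \<open>\<tau>\<close> turns the positive axis into the lower half-plane,
  where \<open>exp (- 2 * \<i> * z)\<close> decays and the cotangent tends to
  \<open>\<i>\<close>.\<close>

lemma cot_lower_limit:
  fixes \<tau> :: complex
  assumes \<tau>: "Im \<tau> > 0"
  shows "(\<lambda>n. cot (of_real pi * (of_real (real n + 1/2) / \<tau>))) \<longlonglongrightarrow> \<i>"
proof -
  define u where "u n = of_real pi * (of_real (real n + 1/2) / \<tau>)" for n
  define e where "e n = exp (- (2 * \<i> * u n))" for n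
  have *: "cot z = \<i> * (1 + exp (- (2 * \<i> * z))) / (1 - exp (- (2 * \<i> * z)))" for z :: complex
  proof -
    have 1: "exp (-(\<i> * z)) = exp (\<i> * z) * exp (- (2 * \<i> * z))" by (simp flip: exp_add)
    have 2: "\<i> * cos z = \<i> / 2 * exp (\<i> * z) * (1 + exp (- (2 * \<i> * z)))"
      "\<i> * sin z = 1 / 2 * exp (\<i> * z) * (1 - exp (- (2 * \<i> * z)))"
      unfolding cos_exp_eq sin_exp_eq 1 by (simp_all add: field_simps)
    have "cot z = (\<i> * cos z) / (\<i> * sin z)" by (simp add: cot_def)
    then show ?thesis unfolding 2 by simp
  qed
  have "norm (e n) = exp (- (2 * pi * (Im \<tau> / norm \<tau> ^ 2)) * (real n + 1/2))" for n
  proof -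
    have "Re (- (2 * \<i> * (of_real pi * v))) = 2 * pi * Im v" for v by simp
    then have "Re (- (2 * \<i> * u n)) = 2 * pi * Im (of_real (real n + 1/2) / \<tau>)"
      unfolding u_def .
    also have "Im (of_real (real n + 1/2) / \<tau>) = - (real n + 1/2) * (Im \<tau> / norm \<tau> ^ 2)"
      unfolding Im_divide cmod_power2 by (simp add: algebra_simps)
    finally have "Re (- (2 * \<i> * u n)) = - (2 * pi * (Im \<tau> / norm \<tau> ^ 2)) * (real n + 1/2)"
      by (simp only: mult_minus_left mult_minus_right mult_ac)
    then show ?thesis unfolding e_def norm_exp_eq_Re by (simp only:)
  qed
  moreover have "(\<lambda>n. exp (- (2 * pi * (Im \<tau> / norm \<tau> ^ 2)) * (real n + 1/2))) \<longlonglongrightarrow> 0"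
  proof (rule filterlim_compose[OF exp_at_bot])
    have "Im \<tau> / norm \<tau> ^ 2 > 0" using \<tau> by (intro divide_pos_pos) auto
    then have c: "- (2 * pi * (Im \<tau> / norm \<tau> ^ 2)) < 0"
      unfolding neg_less_0_iff_less by (intro mult_pos_pos) auto
    show "LIM n sequentially. - (2 * pi * (Im \<tau> / norm \<tau> ^ 2)) * (real n + 1/2) :> at_bot"
      using filterlim_tendsto_add_at_top[OF tendsto_const filterlim_real_sequentially, of "1/2"]
      by (intro filterlim_tendsto_neg_mult_at_bot[OF tendsto_const c]) (simp add: add.commute)
  qed
  ultimately have "e \<longlonglongrightarrow> 0" by (intro tendsto_norm_zero_cancel[of e]) (simp only:)
  then have "(\<lambda>n. \<i> * (1 + e n) / (1 - e n)) \<longlonglongrightarrow> \<i> * (1 + 0) / (1 - 0)"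
    by (intro tendsto_intros) auto
  then show ?thesis unfolding *[of "of_real pi * (of_real (real _ + 1/2) / \<tau>)"] e_def u_def by simp
qed

text \<open>Summed by rows the double series yields \<open>eis_sum \<tau>\<close>, summed by columns
  \<open>eis_sum (- 1 / \<tau>) / \<tau>\<^sup>2\<close>. The two terms with \<open>pi^2 / 6\<close>
  belong to the axes: full rows contain column 0, full columns contain row 0, and the double series
  contains neither.\<close>

lemma eis_sum_inversion:
  assumes \<tau>: "Im \<tau> > 0"
  shows "eis_sum \<tau> = eis_sum (- 1 / \<tau>) / \<tau>\<^sup>2 - of_real pi ^ 2 / 6 + of_real pi ^ 2 / (6 * \<tau>\<^sup>2) + of_real pi * \<i> / \<tau>"
proof -
  have \<tau>0: "\<tau> \<noteq> 0" using \<tau> by auto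
  \<comment> \<open>\<open>B w\<close> is the sum over all rows of the boundary terms at horizontal
    distance \<open>w\<close>. \<open>B (1/2)\<close> comes up once from column 0 and once from
    telescoping over the other columns, and cancels.\<close>
  define B where "B w = 1 / of_real w - of_real pi / \<tau> * cot (of_real pi * (of_real w / \<tau>))" for w :: real
  define s where "s m = of_real pi ^ 2 / sin (of_real pi * (of_nat (Suc m) * \<tau>)) ^ 2" for m
  define s' where "s' n = of_real pi ^ 2 / sin (of_real pi * (of_nat (Suc n) / \<tau>)) ^ 2" for n
  define P where "P w m = 1 / (of_nat (Suc m) * \<tau> - of_real w) - 1 / (of_nat (Suc m) * \<tau> + of_real w)"
    for w :: real and m
  have P: "P w sums B w" if "w > 0" for w
    unfolding P_def B_def by (rule sums_cot_scaled[OF \<tau> that])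
  have basel: "(\<lambda>n. 1 / (of_nat (Suc n) :: complex)\<^sup>2) sums (of_real pi ^ 2 / 6)"
    using sums_of_real[OF inverse_squares_sums, where 'a = complex] by (simp add: add.commute)

  have row: "(\<Sum>n. eis_pair \<tau> m n) = s m - eis_term (of_nat (Suc m) * \<tau>)" for m
    unfolding eis_pair_def s_def using \<tau> by (intro sums_unique[OF eis_row, symmetric]) simp
  have axis: "(\<lambda>m. eis_term (of_nat (Suc m) * \<tau>)) sums (of_real pi ^ 2 / 6 / \<tau>\<^sup>2 - B (1/2))"
  proof -
    have "(\<lambda>m. 1 / (of_nat (Suc m))\<^sup>2 / \<tau>\<^sup>2 - P (1/2) m) sums (of_real pi ^ 2 / 6 / \<tau>\<^sup>2 - B (1/2))"
      by (intro sums_diff sums_divide basel P) simp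
    then show ?thesis
      by (simp add: eis_term_def P_def power_mult_distrib)
  qed
  have "(\<lambda>m. (s m - eis_term (of_nat (Suc m) * \<tau>)) + eis_term (of_nat (Suc m) * \<tau>)) sums
      ((\<Sum>m. \<Sum>n. eis_pair \<tau> m n) + (of_real pi ^ 2 / 6 / \<tau>\<^sup>2 - B (1/2)))"
    using summable_sums[OF eis_pair_swap(1)[OF \<tau>]] unfolding row by (intro sums_add axis)
  then have 1: "eis_sum \<tau> = (\<Sum>m. \<Sum>n. eis_pair \<tau> m n) + (of_real pi ^ 2 / 6 / \<tau>\<^sup>2 - B (1/2))"
    unfolding eis_sum_def s_def[symmetric] by (simp add: sums_iff)

  have col: "(\<Sum>m. eis_pair \<tau> m n) =
      s' n / \<tau>\<^sup>2 - 1 / (of_nat (Suc n))\<^sup>2 - (B (real (Suc n) + 1/2) - B (real n + 1/2))" for n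
  proof (rule sums_unique[symmetric])
    \<comment> \<open>A column is a row of the lattice divided by \<open>\<tau>\<close>.\<close>
    define v where "v = of_nat (Suc n) / \<tau>"
    have "Im v \<noteq> 0" using \<tau> by (simp add: v_def Im_divide)
    from sums_divide[OF sums_inverse_squares_shifted[OF nonreal_not_Int[OF this]], of "\<tau>\<^sup>2"]
    have "(\<lambda>m. (1 / (v + of_nat (Suc m))\<^sup>2 + 1 / (v - of_nat (Suc m))\<^sup>2) / \<tau>\<^sup>2) sums
        ((s' n - 1 / v\<^sup>2) / \<tau>\<^sup>2)"
      by (simp add: s'_def v_def)
    also have "(s' n - 1 / v\<^sup>2) / \<tau>\<^sup>2 = s' n / \<tau>\<^sup>2 - 1 / (of_nat (Suc n))\<^sup>2"
      using \<tau>0 by (simp add: v_def diff_divide_distrib power_divide)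
    finally have "(\<lambda>m. (1 / (v + of_nat (Suc m))\<^sup>2 + 1 / (v - of_nat (Suc m))\<^sup>2) / \<tau>\<^sup>2
        - (P (real (Suc n) + 1/2) m - P (real n + 1/2) m)) sums
        (s' n / \<tau>\<^sup>2 - 1 / (of_nat (Suc n))\<^sup>2 - (B (real (Suc n) + 1/2) - B (real n + 1/2)))"
      by (intro sums_diff P) auto
    moreover have "(1 / (v + of_nat (Suc m))\<^sup>2 + 1 / (v - of_nat (Suc m))\<^sup>2) / \<tau>\<^sup>2
        - (P (real (Suc n) + 1/2) m - P (real n + 1/2) m) = eis_pair \<tau> m n" for m
    proof -
      define z where "z = of_nat (Suc m) * \<tau>"
      have "(v + of_nat (Suc m))\<^sup>2 * \<tau>\<^sup>2 = (z + of_nat (Suc n))\<^sup>2"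
        "(v - of_nat (Suc m))\<^sup>2 * \<tau>\<^sup>2 = (z - of_nat (Suc n))\<^sup>2"
        unfolding power_mult_distrib[symmetric] distrib_right left_diff_distrib power2_eq_iff
        using \<tau>0 by (simp_all add: v_def z_def)
      then have sq: "(1 / (v + of_nat (Suc m))\<^sup>2 + 1 / (v - of_nat (Suc m))\<^sup>2) / \<tau>\<^sup>2 =
         1 / (z + of_nat (Suc n))\<^sup>2 + 1 / (z - of_nat (Suc n))\<^sup>2"
        by (simp only: add_divide_distrib divide_divide_eq_left)
      have sh: "z + of_nat (Suc n) - 1/2 = z + of_real (real n + 1/2)"
        "z + of_nat (Suc n) + 1/2 = z + of_real (real (Suc n) + 1/2)"
        "z - of_nat (Suc n) - 1/2 = z - of_real (real (Suc n) + 1/2)"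
        "z - of_nat (Suc n) + 1/2 = z - of_real (real n + 1/2)"
        by (simp_all add: field_simps)
      show ?thesis
        unfolding sq P_def eis_pair_def eis_term_def z_def[symmetric] sh by (simp only: algebra_simps)
    qed
    ultimately show "(\<lambda>m. eis_pair \<tau> m n) sums
        (s' n / \<tau>\<^sup>2 - 1 / (of_nat (Suc n))\<^sup>2 - (B (real (Suc n) + 1/2) - B (real n + 1/2)))"
      by simp
  qed
  \<comment> \<open>The boundary value at infinity: the sole origin of the term
    \<open>pi * \<i> / \<tau>\<close>.\<close>
  have "(\<lambda>n. B (real n + 1/2)) \<longlonglongrightarrow> 0 - of_real pi / \<tau> * \<i>"
    unfolding B_def
  proof (intro tendsto_diff tendsto_mult tendsto_const cot_lower_limit[OF \<tau>])
    show "(\<lambda>n. 1 / complex_of_real (real n + 1 / 2)) \<longlonglongrightarrow> 0"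
      using tendsto_inverse_shift_nat(1)[of "1/2"] by (simp add: add.commute)
  qed
  from telescope_sums[OF this]
  have tel: "(\<lambda>n. B (real (Suc n) + 1/2) - B (real n + 1/2)) sums (- of_real pi * \<i> / \<tau> - B (1/2))"
    by simp
  have "(\<lambda>n. (s' n / \<tau>\<^sup>2 - 1 / (of_nat (Suc n))\<^sup>2 - (B (real (Suc n) + 1/2) - B (real n + 1/2))) +
       1 / (of_nat (Suc n))\<^sup>2 + (B (real (Suc n) + 1/2) - B (real n + 1/2))) sums
     ((\<Sum>n. \<Sum>m. eis_pair \<tau> m n) + of_real pi ^ 2 / 6 + (- of_real pi * \<i> / \<tau> - B (1/2)))"
    using summable_sums[OF eis_pair_swap(2)[OF \<tau>]] unfolding col by (intro sums_add basel tel)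
  then have "(\<lambda>n. s' n / \<tau>\<^sup>2) sums
     ((\<Sum>n. \<Sum>m. eis_pair \<tau> m n) + of_real pi ^ 2 / 6 + (- of_real pi * \<i> / \<tau> - B (1/2)))"
    by simp
  \<comment> \<open>The squared sine is even, so the sign of \<open>- 1 / \<tau>\<close> is
    lost.\<close>
  moreover have "eis_sum (- 1 / \<tau>) = suminf s'"
    unfolding eis_sum_def s'_def by simp
  ultimately have 2: "eis_sum (- 1 / \<tau>) / \<tau>\<^sup>2 =
      (\<Sum>n. \<Sum>m. eis_pair \<tau> m n) + of_real pi ^ 2 / 6 + (- of_real pi * \<i> / \<tau> - B (1/2))"
    using \<tau>0 suminf_divide[of s' "\<tau>\<^sup>2"] summable_mult2[of "\<lambda>n. s' n / \<tau>\<^sup>2" "\<tau>\<^sup>2"]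
    by (simp add: sums_iff)
  show ?thesis
    unfolding 1 2 eis_pair_swap(3)[OF \<tau>] by (simp add: algebra_simps)
qed

section \<open>Lambert series and the derivative of log eta\<close>

text \<open>Both series are the double series of \<open>n * q^(n * k)\<close> over positive
  \<open>n\<close> and \<open>k\<close>: a geometric series in \<open>k\<close>, the derivative of
  one in \<open>n\<close>.\<close>

lemma lambert_series_swap:
  fixes q :: complex
  assumes q: "norm q < 1"
  shows "summable (\<lambda>k. q ^ Suc k / (1 - q ^ Suc k)\<^sup>2)"
    "(\<lambda>n. of_nat (Suc n) * (q ^ Suc n / (1 - q ^ Suc n))) sums (\<Sum>k. q ^ Suc k / (1 - q ^ Suc k)\<^sup>2)"
proof -
  have pw: "norm (q ^ Suc n) < 1" for n
    using power_Suc_less_one[of "norm q" n] q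
    by (cases "q = 0") (auto simp: norm_power norm_mult intro: order.strict_trans1[OF mult_left_le])
  define f where "f n k = of_nat (Suc n) * (q ^ Suc n) ^ Suc k" for n k
  have f': "f n k = q ^ Suc k * (of_nat (Suc n) * (q ^ Suc k) ^ n)" for n k
    unfolding f_def by (simp add: power_mult[symmetric] power_add[symmetric] algebra_simps)
  have row: "(\<Sum>k. f n k) = of_nat (Suc n) * (q ^ Suc n / (1 - q ^ Suc n))" for n
  proof -
    have "(\<lambda>k. of_nat (Suc n) * (q ^ Suc n * (q ^ Suc n) ^ k)) sums
       (of_nat (Suc n) * (q ^ Suc n * (1 / (1 - q ^ Suc n))))"
      by (intro sums_mult geometric_sums pw)
    then show ?thesis unfolding f_def by (simp add: sums_iff)
  qed
  have col: "(\<Sum>n. f n k) = q ^ Suc k / (1 - q ^ Suc k)\<^sup>2" for k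
  proof -
    have "(\<lambda>n. q ^ Suc k * (of_nat (Suc n) * (q ^ Suc k) ^ n)) sums (q ^ Suc k * (1 / (1 - q ^ Suc k)\<^sup>2))"
      by (intro sums_mult geometric_deriv_sums pw)
    then show ?thesis unfolding f' by (simp add: sums_iff)
  qed
  have "norm (f n k) \<le> (real (Suc n) * norm q ^ n) * norm q ^ k" for n k
  proof -
    \<comment> \<open>A crude bound on the exponent that separates the two variables.\<close>
    have "norm q ^ (Suc n * Suc k) \<le> norm q ^ (n + k)"
      using q by (intro power_decreasing) auto
    then have "real (Suc n) * norm q ^ (Suc n * Suc k) \<le> real (Suc n) * norm q ^ (n + k)"
      by (intro mult_left_mono) auto
    then show ?thesis
      unfolding f_def power_mult[symmetric] norm_mult norm_power norm_of_nat by (simp add: power_add mult_ac)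
  qed
  note swap = double_series_swap[where f = f and a = "\<lambda>n. real (Suc n) * norm q ^ n" and b = "\<lambda>k. norm q ^ k",
      OF sums_summable[OF geometric_deriv_sums] summable_geometric this]
  have "summable (\<lambda>n. \<Sum>k. f n k)" "summable (\<lambda>k. \<Sum>n. f n k)"
    "(\<Sum>n. \<Sum>k. f n k) = (\<Sum>k. \<Sum>n. f n k)"
    by (rule swap; use q in simp)+
  then show "summable (\<lambda>k. q ^ Suc k / (1 - q ^ Suc k)\<^sup>2)"
    "(\<lambda>n. of_nat (Suc n) * (q ^ Suc n / (1 - q ^ Suc n))) sums (\<Sum>k. q ^ Suc k / (1 - q ^ Suc k)\<^sup>2)"
    unfolding row col by (simp_all add: sums_iff)
qed

text \<open>Every factor of the eta product has positive real part, so the principal logarithms of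
  the factors never jump; their sum is a branch on the whole half-plane, which \<open>Ln\<close> of
  the product would not be.\<close>

definition log_eta :: "complex \<Rightarrow> complex" where
  "log_eta \<tau> = of_real pi * \<i> * \<tau> / 12 + (\<Sum>n. Ln (1 - exp (2 * of_real pi * \<i> * of_nat (Suc n) * \<tau>)))"

lemma norm_nome: "norm (exp (2 * of_real pi * \<i> * of_nat (Suc n) * \<tau>)) = exp (- 2 * pi * Im \<tau>) ^ Suc n"
proof -
  have "Re (2 * of_real pi * \<i> * of_nat (Suc n) * \<tau>) = real (Suc n) * (- 2 * pi * Im \<tau>)" by simp
  then show ?thesis unfolding norm_exp_eq_Re by (simp only: exp_of_nat_mult)
qed

lemma norm_nome_less_1: "Im \<tau> > 0 \<Longrightarrow> norm (exp (2 * of_real pi * \<i> * of_nat (Suc n) * \<tau>)) < 1"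
  unfolding norm_nome by (intro power_Suc_less_one) auto

text \<open>In exponentials, \<open>pi^2 / sin^2\<close> is
  \<open>- 4 * pi^2 * q / (1 - q)^2\<close>. The Lambert identity then produces exactly the
  derivatives of the summands of \<open>log_eta\<close>.\<close>

lemma eis_sum_nome:
  assumes \<tau>: "Im \<tau> > 0"
  shows "(\<lambda>n. - exp (2 * of_real pi * \<i> * of_nat (Suc n) * \<tau>) * (2 * of_real pi * \<i> * of_nat (Suc n)) /
    (1 - exp (2 * of_real pi * \<i> * of_nat (Suc n) * \<tau>))) sums (\<i> / (2 * of_real pi) * eis_sum \<tau>)"
proof -
  define q where "q = exp (2 * of_real pi * \<i> * \<tau>)"
  have e: "exp (2 * of_real pi * \<i> * of_nat (Suc n) * \<tau>) = q ^ Suc n" for n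
    unfolding q_def exp_of_nat_mult[symmetric] by (simp add: mult_ac)
  have q: "norm q < 1" using norm_nome_less_1[OF \<tau>, of 0] unfolding e by simp
  have "of_real pi ^ 2 / sin (of_real pi * (of_nat (Suc m) * \<tau>)) ^ 2 =
      - 4 * of_real pi ^ 2 * (q ^ Suc m / (1 - q ^ Suc m)\<^sup>2)" for m
  proof -
    define w where "w = exp (\<i> * (of_real pi * (of_nat (Suc m) * \<tau>)))"
    have w: "w \<noteq> 0" "q ^ Suc m = w * w"
      unfolding e[symmetric] w_def exp_add[symmetric] by (simp_all add: algebra_simps)
    have "sin (of_real pi * (of_nat (Suc m) * \<tau>)) = (w - 1 / w) / (2 * \<i>)"
      unfolding sin_exp_eq w_def by (simp add: exp_minus inverse_eq_divide)
    then have "sin (of_real pi * (of_nat (Suc m) * \<tau>)) ^ 2 = - ((w - 1 / w)\<^sup>2 / 4)"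
      by (simp add: power_divide power_mult_distrib)
    also have "(w - 1 / w)\<^sup>2 = (1 - w * w)\<^sup>2 / (w * w)"
      using w(1) by (simp add: power2_eq_square field_simps)
    finally show ?thesis unfolding w(2) using w(1) by simp
  qed
  then have "eis_sum \<tau> = (\<Sum>m. - 4 * of_real pi ^ 2 * (q ^ Suc m / (1 - q ^ Suc m)\<^sup>2))"
    unfolding eis_sum_def by simp
  also have "\<dots> = - 4 * of_real pi ^ 2 * (\<Sum>m. q ^ Suc m / (1 - q ^ Suc m)\<^sup>2)"
  proof (rule suminf_mult)
    show "summable (\<lambda>m. q ^ Suc m / (1 - q ^ Suc m)\<^sup>2)" by (rule lambert_series_swap(1)[OF q])
  qed
  finally have "\<i> / (2 * of_real pi) * eis_sum \<tau> = - 2 * of_real pi * \<i> * (\<Sum>m. q ^ Suc m / (1 - q ^ Suc m)\<^sup>2)"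
    by (simp add: power2_eq_square)
  moreover have "(\<lambda>n. - 2 * of_real pi * \<i> * (of_nat (Suc n) * (q ^ Suc n / (1 - q ^ Suc n)))) sums
    (- 2 * of_real pi * \<i> * (\<Sum>m. q ^ Suc m / (1 - q ^ Suc m)\<^sup>2))"
    by (intro sums_mult lambert_series_swap(2) q)
  ultimately show ?thesis unfolding e by (simp add: mult_ac)
qed

lemma log_eta_deriv:
  assumes \<tau>: "Im \<tau> > 0"
  shows "summable (\<lambda>n. Ln (1 - exp (2 * of_real pi * \<i> * of_nat (Suc n) * \<tau>)))" (is ?summ)
    and "(log_eta has_field_derivative of_real pi * \<i> / 12 + \<i> / (2 * of_real pi) * eis_sum \<tau>) (at \<tau>)" (is ?deriv)
proof -
  let ?S = "{\<tau>. Im \<tau> > 0}"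
  define e where "e n \<tau> = exp (2 * of_real pi * \<i> * of_nat (Suc n) * \<tau>)" for n \<tau>
  have op: "open ?S" by (rule open_halfspace_Im_gt)
  have "\<exists>g g'. \<forall>x\<in>?S. (\<lambda>n. Ln (1 - e n x)) sums g x \<and>
      (\<lambda>n. - e n x * (2 * of_real pi * \<i> * of_nat (Suc n)) / (1 - e n x)) sums g' x \<and> (g has_field_derivative g' x) (at x)"
  proof (rule series_and_derivative_comparison_complex[OF op])
    fix n :: nat and x :: complex assume "x \<in> ?S"
    then have "norm (e n x) < 1" unfolding e_def by (intro norm_nome_less_1) auto
    then have "Re (1 - e n x) > 0" using complex_Re_le_cmod[of "e n x"] by simp
    then have "1 - e n x \<notin> \<real>\<^sub>\<le>\<^sub>0" by (auto simp: complex_nonpos_Reals_iff)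
    then show "((\<lambda>x. Ln (1 - e n x)) has_field_derivative
        - e n x * (2 * of_real pi * \<i> * of_nat (Suc n)) / (1 - e n x)) (at x)"
      unfolding e_def by (auto intro!: derivative_eq_intros simp: divide_inverse mult_ac)
  next
    fix x assume x: "x \<in> ?S"
    \<comment> \<open>On the ball of radius \<open>Im x / 2\<close> the height stays above half of
      \<open>Im x\<close>, so this single \<open>r\<close> dominates every nome there;
      \<open>norm_Ln_le\<close> then gives the majorant \<open>2 * r ^ n\<close>.\<close>
    define r where "r = exp (- 2 * pi * (Im x / 2))"
    have r: "0 < r" "r < 1" using x by (auto simp: r_def)
    have "(\<lambda>n. r ^ n) \<longlonglongrightarrow> 0" using r by (intro LIMSEQ_power_zero) auto
    then have ev: "\<forall>\<^sub>F n in sequentially. r ^ n < 1/2" by (rule order_tendstoD) simp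
    have bd: "cmod (Ln (1 - e n y)) \<le> 2 * r ^ n" if "r ^ n < 1/2" "y \<in> ball x (Im x / 2)" for n y
    proof -
      have "\<bar>Im (x - y)\<bar> < Im x / 2" using that(2) abs_Im_le_cmod[of "x - y"] by (simp add: dist_norm)
      then have y: "Im y \<ge> Im x / 2" by (simp add: abs_if split: if_splits)
      have "norm (e n y) = exp (- 2 * pi * Im y) ^ Suc n" unfolding e_def by (rule norm_nome)
      also have "\<dots> \<le> r ^ Suc n" unfolding r_def using y by (intro power_mono) auto
      also have "\<dots> \<le> r ^ n" using r by (intro power_decreasing) auto
      finally have "norm (e n y) \<le> r ^ n" .
      with norm_Ln_le[of "- e n y"] that(1) show ?thesis by simp
    qed
    have "summable (\<lambda>n. complex_of_real (2 * r ^ n))"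
      using r by (intro summable_of_real summable_mult summable_geometric) auto
    moreover have "\<forall>\<^sub>F n in sequentially. \<forall>y\<in>ball x (Im x / 2) \<inter> ?S. cmod (Ln (1 - e n y)) \<le> cmod (complex_of_real (2 * r ^ n))"
      using ev by eventually_elim (use bd r in \<open>auto simp: norm_mult norm_power\<close>)
    ultimately show "\<exists>d h. 0 < d \<and> summable h \<and> range h \<subseteq> \<real>\<^sub>\<ge>\<^sub>0 \<and>
        (\<forall>\<^sub>F n in sequentially. \<forall>y\<in>ball x d \<inter> ?S. cmod (Ln (1 - e n y)) \<le> cmod (h n))"
      using x r by (intro exI[of _ "Im x / 2"] exI[of _ "\<lambda>n. complex_of_real (2 * r ^ n)"]) (auto simp del: of_real_mult of_real_power)
  qed
  then obtain g g' where g: "\<And>x. Im x > 0 \<Longrightarrow> (\<lambda>n. Ln (1 - e n x)) sums g x"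
    "\<And>x. Im x > 0 \<Longrightarrow> (\<lambda>n. - e n x * (2 * of_real pi * \<i> * of_nat (Suc n)) / (1 - e n x)) sums g' x"
    "\<And>x. Im x > 0 \<Longrightarrow> (g has_field_derivative g' x) (at x)"
    by auto
  from g(1)[OF \<tau>] show ?summ unfolding e_def by (rule sums_summable)
  have "g' \<tau> = \<i> / (2 * of_real pi) * eis_sum \<tau>"
    using g(2)[OF \<tau>] eis_sum_nome[OF \<tau>] unfolding e_def by (rule sums_unique2)
  then have "((\<lambda>x. of_real pi * \<i> * x / 12 + g x) has_field_derivative
      of_real pi * \<i> / 12 + \<i> / (2 * of_real pi) * eis_sum \<tau>) (at \<tau>)"
    using g(3)[OF \<tau>] by (auto intro!: derivative_eq_intros)
  then show ?deriv
    by (rule has_field_derivative_transform_within_open[OF _ op])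
      (use \<tau> g(1) in \<open>auto simp: log_eta_def e_def sums_iff\<close>)
qed

lemma dedekind_eta_eq_exp:
  assumes \<tau>: "Im \<tau> > 0"
  shows "dedekind_eta \<tau> = exp (log_eta \<tau>)"
proof -
  have "exp (Ln (1 - exp (2 * of_real pi * \<i> * of_nat (Suc n) * \<tau>))) = 1 - exp (2 * of_real pi * \<i> * of_nat (Suc n) * \<tau>)" for n
    using norm_nome_less_1[OF \<tau>, of n] by (intro exp_Ln) (metis less_irrefl norm_one right_minus_eq)
  with prodinf_exp[OF log_eta_deriv(1)[OF \<tau>]] show ?thesis
    unfolding dedekind_eta_def log_eta_def exp_add by (simp add: mult_ac)
qed

section \<open>Translation and inversion of log eta\<close>

lemma log_eta_plus_1: "log_eta (\<tau> + 1) = log_eta \<tau> + of_real pi * \<i> / 12"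
proof -
  have "exp (2 * of_real pi * \<i> * of_nat (Suc n) * (\<tau> + 1)) = exp (2 * of_real pi * \<i> * of_nat (Suc n) * \<tau>)" for n
  proof -
    have "2 * of_real pi * \<i> * of_nat (Suc n) * (\<tau> + 1) =
       2 * of_real pi * \<i> * of_nat (Suc n) * \<tau> + of_nat (Suc n) * (2 * of_real pi * \<i>)"
      by (simp add: algebra_simps)
    then show ?thesis by (simp only: exp_add exp_of_nat_mult exp_two_pi_i power_one mult_1_right)
  qed
  then show ?thesis unfolding log_eta_def by (simp add: field_simps)
qed

text \<open>By \<open>eis_sum_inversion\<close> the difference of both sides has derivative zero:
  the logarithm absorbs the term \<open>pi * \<i> / \<tau>\<close>. At \<open>\<i>\<close> the
  difference vanishes because \<open>- 1 / \<i> = \<i>\<close> and \<open>Ln 1 = 0\<close>.\<close>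

lemma log_eta_inversion:
  assumes \<tau>: "Im \<tau> > 0"
  shows "log_eta (- 1 / \<tau>) = log_eta \<tau> + Ln (\<tau> / \<i>) / 2"
proof -
  let ?S = "{\<tau>. Im \<tau> > 0}"
  define h where "h \<tau> = log_eta (- 1 / \<tau>) - log_eta \<tau> - Ln (\<tau> / \<i>) / 2" for \<tau>
  have "(h has_field_derivative 0) (at \<tau> within ?S)" if "\<tau> \<in> ?S" for \<tau>
  proof -
    have \<tau>: "Im \<tau> > 0" "Im (- 1 / \<tau>) > 0" "\<tau> \<noteq> 0" using that by (auto simp: Im_divide intro!: divide_pos_pos add_nonneg_pos)
    have "\<tau> / \<i> \<notin> \<real>\<^sub>\<le>\<^sub>0" using \<tau> by (auto simp: complex_nonpos_Reals_iff)
    then have "(h has_field_derivative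
       (of_real pi * \<i> / 12 + \<i> / (2 * of_real pi) * eis_sum (- 1 / \<tau>)) * (1 / \<tau>\<^sup>2) -
       (of_real pi * \<i> / 12 + \<i> / (2 * of_real pi) * eis_sum \<tau>) - 1 / (2 * \<tau>)) (at \<tau>)"
      unfolding h_def using \<tau>
      by (auto intro!: derivative_eq_intros DERIV_chain2[OF log_eta_deriv(2)] log_eta_deriv(2) simp: power2_eq_square field_simps)
    also have "(of_real pi * \<i> / 12 + \<i> / (2 * of_real pi) * eis_sum (- 1 / \<tau>)) * (1 / \<tau>\<^sup>2) -
       (of_real pi * \<i> / 12 + \<i> / (2 * of_real pi) * eis_sum \<tau>) - 1 / (2 * \<tau>) = 0"
      unfolding eis_sum_inversion[OF \<tau>(1)] using \<tau>(3) by (simp add: field_simps power2_eq_square)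
    finally show ?thesis by (rule has_field_derivative_at_within)
  qed
  moreover have "convex ?S" by (rule convex_halfspace_Im_gt)
  ultimately have "h \<tau> = h \<i>"
    using \<tau> has_field_derivative_zero_constant[of ?S h] by auto
  also have "h \<i> = 0" unfolding h_def by simp
  finally show ?thesis unfolding h_def diff_diff_eq right_minus_eq .
qed

subsection \<open>Logarithms of the eta quotients\<close>

definition log_Delta_Z :: "complex \<Rightarrow> complex" where
  "log_Delta_Z \<tau> = 24 * log_eta (2 * \<tau>) - 24 * log_eta \<tau>"

definition log_Delta_Z4 :: "complex \<Rightarrow> complex" where
  "log_Delta_Z4 \<tau> = 8 * log_eta (2 * \<tau>) - 16 * log_eta \<tau>"

lemma holomorphic_log_eta: "f holomorphic_on A \<Longrightarrow> f ` A \<subseteq> upper_half_plane \<Longrightarrow> (\<lambda>x. log_eta (f x)) holomorphic_on A"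
  using holomorphic_on_compose_gen[of f A log_eta upper_half_plane]
  by (force simp: o_def holomorphic_on_open[OF open_halfspace_Im_gt] dest: log_eta_deriv(2))

lemma log_branch_log_Delta_Z: "log_branch Delta_Z log_Delta_Z"
  unfolding log_branch_def log_Delta_Z_def Delta_Z_def
  by (auto intro!: holomorphic_intros holomorphic_log_eta
      simp: dedekind_eta_eq_exp exp_diff exp_of_nat_mult[of 24, simplified])

lemma log_branch_log_Delta_Z4: "log_branch Delta_Z4 log_Delta_Z4"
  unfolding log_branch_def log_Delta_Z4_def Delta_Z4_def
  by (auto intro!: holomorphic_intros holomorphic_log_eta
      simp: dedekind_eta_eq_exp exp_diff exp_of_nat_mult[of 8, simplified] exp_of_nat_mult[of 16, simplified])

lemma log_eta_plus_2: "log_eta (\<tau> + 2) = log_eta \<tau> + of_real pi * \<i> / 6"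
  using log_eta_plus_1[of "\<tau> + 1"] log_eta_plus_1[of \<tau>] by (simp add: add.assoc)

lemma log_Delta_Z_plus_1: "log_Delta_Z (\<tau> + 1) = log_Delta_Z \<tau> + 2 * of_real pi * \<i>"
  using log_eta_plus_2[of "2 * \<tau>"] log_eta_plus_1[of \<tau>]
  by (simp add: log_Delta_Z_def algebra_simps)

lemma log_Delta_Z4_plus_1: "log_Delta_Z4 (\<tau> + 1) = log_Delta_Z4 \<tau>"
  using log_eta_plus_2[of "2 * \<tau>"] log_eta_plus_1[of \<tau>]
  by (simp add: log_Delta_Z4_def algebra_simps)

lemma Im_minus_inverse_pos: "Im \<tau> > 0 \<Longrightarrow> Im (- 1 / \<tau>) > 0"
  by (auto simp: Im_divide intro!: divide_pos_pos add_nonneg_pos)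

lemma Ln_scale: "r > 0 \<Longrightarrow> z \<noteq> 0 \<Longrightarrow> Ln (of_real r * z) = of_real (ln r) + Ln z"
  using Ln_times_of_real[of r z] by (simp add: Ln_of_real)

text \<open>Inversion at \<open>2 * \<tau>\<close> and at \<open>\<tau>\<close> respectively, so the
  two etas of a level-2 quotient trade places. The extra \<open>ln 2\<close> comes from
  \<open>Ln (2 * \<tau> / \<i>)\<close>.\<close>

lemma log_eta_Fricke:
  assumes \<tau>: "Im \<tau> > 0"
  shows "log_eta (- 1 / (2 * \<tau>)) = log_eta (2 * \<tau>) + of_real (ln 2) / 2 + Ln (\<tau> / \<i>) / 2"
    and "log_eta (2 * (- 1 / (2 * \<tau>))) = log_eta \<tau> + Ln (\<tau> / \<i>) / 2"
proof -
  have "Ln (2 * \<tau> / \<i>) = of_real (ln 2) + Ln (\<tau> / \<i>)"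
  proof -
    have "\<tau> / \<i> \<noteq> 0" using \<tau> by auto
    from Ln_scale[OF _ this, of 2] show ?thesis by (simp add: mult_ac)
  qed
  then show "log_eta (- 1 / (2 * \<tau>)) = log_eta (2 * \<tau>) + of_real (ln 2) / 2 + Ln (\<tau> / \<i>) / 2"
    using log_eta_inversion[of "2 * \<tau>"] \<tau> by (simp add: add_divide_distrib)
  show "log_eta (2 * (- 1 / (2 * \<tau>))) = log_eta \<tau> + Ln (\<tau> / \<i>) / 2"
    using log_eta_inversion[OF \<tau>] by simp
qed

text \<open>The map \<open>X\<close> is \<open>W T\<^sup>-\<^sup>1 W T\<^sup>-\<^sup>1\<close> for the Fricke involution \<open>W \<tau> = - 1 / (2 \<tau>)\<close>, under which the
  level-2 eta quotients are exchanged.\<close>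

lemma X_via_Fricke:
  assumes \<tau>: "Im \<tau> > 0"
  obtains \<sigma> u where "Im \<sigma> > 0" "Im u > 0" "\<tau> = \<sigma> + 1" "u + 1 = - 1 / (2 * \<sigma>)"
    "(\<tau> - 1) / (2 * \<tau> - 1) = - 1 / (2 * u)" "2 * \<tau> - 1 = 2 * ((u / \<i>) * (\<sigma> / \<i>))"
proof -
  define \<sigma> where "\<sigma> = \<tau> - 1"
  define u where "u = - 1 / (2 * \<sigma>) - 1"
  have \<sigma>: "Im \<sigma> > 0" "\<sigma> \<noteq> 0" using \<tau> by (auto simp: \<sigma>_def)
  have u: "Im u > 0" using Im_minus_inverse_pos[of "2 * \<sigma>"] \<sigma> by (simp add: u_def)
  have u2: "2 * u = - (2 * \<tau> - 1) / \<sigma>" using \<sigma> by (simp add: u_def \<sigma>_def field_simps)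
  show thesis
  proof (rule that[OF \<sigma>(1) u])
    show "(\<tau> - 1) / (2 * \<tau> - 1) = - 1 / (2 * u)"
      unfolding u2 \<sigma>_def[symmetric] by (simp add: minus_divide_right)
    show "2 * \<tau> - 1 = 2 * ((u / \<i>) * (\<sigma> / \<i>))"
      using u2 \<sigma> by (simp add: field_simps)
  qed (simp_all add: \<sigma>_def u_def)
qed

lemma log_Delta_Z_X:
  assumes \<tau>: "Im \<tau> > 0"
  shows "log_Delta_Z ((\<tau> - 1) / (2 * \<tau> - 1)) = log_Delta_Z \<tau>"
proof -
  obtain \<sigma> u where *: "Im \<sigma> > 0" "Im u > 0" "\<tau> = \<sigma> + 1" "u + 1 = - 1 / (2 * \<sigma>)"
    "(\<tau> - 1) / (2 * \<tau> - 1) = - 1 / (2 * u)"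
    using X_via_Fricke[OF \<tau>] by metis
  \<comment> \<open>Numerator and denominator have equal weight, so only a constant and a change of
    sign remain. In \<open>X\<close> the involution occurs twice: the constants cancel, and so do
    the \<open>2 * pi * \<i>\<close> of the two translations.\<close>
  have W: "log_Delta_Z (- 1 / (2 * z)) = - log_Delta_Z z - 12 * of_real (ln 2)" if "Im z > 0" for z
    unfolding log_Delta_Z_def log_eta_Fricke[OF that] by (simp add: algebra_simps)
  have "log_Delta_Z (- 1 / (2 * u)) = - log_Delta_Z (u + 1) + 2 * of_real pi * \<i> - 12 * of_real (ln 2)"
    unfolding W[OF *(2)] log_Delta_Z_plus_1 by simp
  also have "\<dots> = log_Delta_Z \<sigma> + 2 * of_real pi * \<i>"
    unfolding *(4) W[OF *(1)] by simp
  finally show ?thesis unfolding *(5) unfolding *(3) log_Delta_Z_plus_1 .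
qed

lemma log_Delta_Z4_X:
  assumes \<tau>: "Im \<tau> > 0"
  shows "log_Delta_Z4 ((\<tau> - 1) / (2 * \<tau> - 1)) = log_Delta_Z4 \<tau> + 2 * of_real pi * \<i> - 4 * Ln (2 * \<tau> - 1)"
proof -
  obtain \<sigma> u where *: "Im \<sigma> > 0" "Im u > 0" "\<tau> = \<sigma> + 1" "u + 1 = - 1 / (2 * \<sigma>)"
    "(\<tau> - 1) / (2 * \<tau> - 1) = - 1 / (2 * u)" "2 * \<tau> - 1 = 2 * ((u / \<i>) * (\<sigma> / \<i>))"
    using X_via_Fricke[OF \<tau>] by metis
  \<comment> \<open>The logarithm of the eta quotient that the Fricke involution exchanges with
    \<open>Delta_Z4\<close>.\<close>
  define H where "H z = 8 * log_eta z - 16 * log_eta (2 * z)" for z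
  have H1: "H (z + 1) = H z - 2 * of_real pi * \<i>" for z
    using log_eta_plus_2[of "2 * z"] log_eta_plus_1[of z] by (simp add: H_def algebra_simps)
  have W: "log_Delta_Z4 (- 1 / (2 * z)) = H z - 4 * Ln (z / \<i>) - 8 * of_real (ln 2)"
    "H (- 1 / (2 * z)) = log_Delta_Z4 z + 4 * of_real (ln 2) - 4 * Ln (z / \<i>)" if "Im z > 0" for z
    unfolding log_Delta_Z4_def H_def log_eta_Fricke[OF that] by (simp_all add: algebra_simps)
  have nz: "u / \<i> \<noteq> 0" "\<sigma> / \<i> \<noteq> 0" using * by force+
  \<comment> \<open>Both numbers lie in the right half-plane, so their arguments add up to less than
    \<open>pi\<close> and the principal logarithms add without a multiple of
    \<open>2 * pi * \<i>\<close>.\<close>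
  have "\<bar>Im (Ln (u / \<i>))\<bar> < pi / 2" "\<bar>Im (Ln (\<sigma> / \<i>))\<bar> < pi / 2"
    using *(1,2) by (intro Re_Ln_pos_lt_imp; simp)+
  then have "Ln ((u / \<i>) * (\<sigma> / \<i>)) = Ln (u / \<i>) + Ln (\<sigma> / \<i>)"
    using nz by (intro Ln_times_simple) (auto simp: abs_less_iff)
  then have L: "Ln (2 * \<tau> - 1) = of_real (ln 2) + Ln (u / \<i>) + Ln (\<sigma> / \<i>)"
    unfolding *(6) using Ln_scale[of 2 "(u / \<i>) * (\<sigma> / \<i>)"] nz by simp
  have "log_Delta_Z4 (- 1 / (2 * u)) = H (u + 1) + 2 * of_real pi * \<i> - 4 * Ln (u / \<i>) - 8 * of_real (ln 2)"
    unfolding W(1)[OF *(2)] H1 by simp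
  also have "\<dots> = log_Delta_Z4 \<sigma> + 2 * of_real pi * \<i> - 4 * Ln (2 * \<tau> - 1)"
    unfolding *(4) W(2)[OF *(1)] L by simp
  finally show ?thesis unfolding *(5) unfolding *(3) log_Delta_Z4_plus_1 .
qed

text \<open>The difference of two branches has exponential 1, hence derivative zero on a convex set.
  This carries everything known about the explicit logarithms to an arbitrary branch.\<close>

lemma log_branch_unique:
  assumes "log_branch f L" "log_branch f L'"
  obtains k :: int where "\<And>\<tau>. Im \<tau> > 0 \<Longrightarrow> L \<tau> = L' \<tau> + 2 * of_real pi * \<i> * of_int k"
proof -
  let ?S = "{\<tau>. Im \<tau> > 0}"
  have op: "open ?S" by (rule open_halfspace_Im_gt)
  have ex: "exp (L \<tau> - L' \<tau>) = 1" if "\<tau> \<in> ?S" for \<tau>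
    using assms that exp_not_eq_zero[of "L' \<tau>"] unfolding log_branch_def exp_diff by auto
  have "((\<lambda>\<tau>. L \<tau> - L' \<tau>) has_field_derivative 0) (at \<tau> within ?S)" if \<tau>: "\<tau> \<in> ?S" for \<tau>
  proof -
    have "(\<lambda>\<tau>. L \<tau> - L' \<tau>) holomorphic_on ?S"
      using assms unfolding log_branch_def by (auto intro!: holomorphic_intros)
    then obtain d where d: "((\<lambda>\<tau>. L \<tau> - L' \<tau>) has_field_derivative d) (at \<tau>)"
      using \<tau> holomorphic_on_open[OF op] by blast
    then have "((\<lambda>\<tau>. exp (L \<tau> - L' \<tau>)) has_field_derivative exp (L \<tau> - L' \<tau>) * d) (at \<tau>)"
      by (rule DERIV_chain2[OF DERIV_exp])
    moreover have "((\<lambda>\<tau>. exp (L \<tau> - L' \<tau>)) has_field_derivative 0) (at \<tau>)"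
      by (rule has_field_derivative_transform_within_open[OF DERIV_const[of 1] op \<tau>]) (use ex in auto)
    ultimately have "d = 0" using DERIV_unique by fastforce
    with d show ?thesis by (auto intro: has_field_derivative_at_within)
  qed
  then obtain c where c: "\<And>\<tau>. \<tau> \<in> ?S \<Longrightarrow> L \<tau> - L' \<tau> = c"
    using has_field_derivative_zero_constant[OF convex_halfspace_Im_gt, of 0 "\<lambda>\<tau>. L \<tau> - L' \<tau>"] by auto
  have "exp c = 1" using ex[of \<i>] c[of \<i>] by simp
  then obtain k :: int where "Re c = 0" "Im c = of_int (2 * k) * pi"
    unfolding exp_eq_1 by blast
  then have "c = of_int (2 * k) * of_real pi * \<i>" by (simp add: complex_eq_iff)
  then show thesis using c by (intro that[of k]) (auto simp: algebra_simps)
qed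


subsection \<open>Generators of \<open>\<Gamma>\<^sub>0(2)\<close>\<close>

definition mat2 :: "int \<Rightarrow> int \<Rightarrow> int \<Rightarrow> int \<Rightarrow> int^2^2" where
  "mat2 a b c d = vector [vector [a, b], vector [c, d]]"

lemma mat2_nth [simp]:
  "mat2 a b c d $ 1 $ 1 = a" "mat2 a b c d $ 1 $ 2 = b" "mat2 a b c d $ 2 $ 1 = c" "mat2 a b c d $ 2 $ 2 = d"
  by (simp_all add: mat2_def)

lemma mat2_eq_iff: "A = B \<longleftrightarrow> A $ 1 $ 1 = B $ 1 $ 1 \<and> A $ 1 $ 2 = B $ 1 $ 2 \<and> A $ 2 $ 1 = B $ 2 $ 1 \<and> A $ 2 $ 2 = B $ 2 $ 2"
  for A B :: "int^2^2"
  by (auto simp: vec_eq_iff forall_2)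

lemma mat2_cases: obtains a b c d where "A = mat2 a b c d"
  using mat2_eq_iff[of A "mat2 (A$1$1) (A$1$2) (A$2$1) (A$2$2)"] by auto

lemma mat2_mult [simp]:
  "mat2 a b c d ** mat2 a' b' c' d' = mat2 (a * a' + b * c') (a * b' + b * d') (c * a' + d * c') (c * b' + d * d')"
  by (simp add: mat2_eq_iff matrix_matrix_mult_def sum_2)

lemma mat2_inject [simp]: "mat2 a b c d = mat2 a' b' c' d' \<longleftrightarrow> a = a' \<and> b = b' \<and> c = c' \<and> d = d'"
  by (simp add: mat2_eq_iff)

lemma mat_1_eq_mat2: "mat 1 = mat2 1 0 0 1"
  and T_mat_eq_mat2: "T_mat = mat2 1 1 0 1"
  and X_mat_eq_mat2: "X_mat = mat2 1 (-1) 2 (-1)"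
  by (simp_all add: mat2_eq_iff mat_def T_mat_def X_mat_def)

lemma det_mat2 [simp]: "det (mat2 a b c d) = a * d - b * c"
  by (simp add: det_2)

lemma mat2_in_Gamma0_2 [simp]: "mat2 a b c d \<in> carrier Gamma0_2 \<longleftrightarrow> a * d - b * c = 1 \<and> even c"
  by (simp add: Gamma0_2_def even_iff_mod_2_eq_zero)

lemma mult_Gamma0_2 [simp]: "A \<otimes>\<^bsub>Gamma0_2\<^esub> B = A ** B"
  and one_Gamma0_2 [simp]: "\<one>\<^bsub>Gamma0_2\<^esub> = mat 1"
  by (simp_all add: Gamma0_2_def)

lemma det_Gamma0_2: "A \<in> carrier Gamma0_2 \<Longrightarrow> det A = 1"
  by (simp add: Gamma0_2_def)

lemma mat2_left_inverse: "mat2 a b c d \<in> carrier Gamma0_2 \<Longrightarrow> mat2 d (- b) (- c) a ** mat2 a b c d = mat 1"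
  by (simp add: mat_1_eq_mat2 algebra_simps)

lemma group_Gamma0_2: "group Gamma0_2"
proof (rule groupI)
  fix A B :: "int^2^2"
  assume AB: "A \<in> carrier Gamma0_2" "B \<in> carrier Gamma0_2"
  then have "det (A ** B) = 1" by (simp add: det_mul det_Gamma0_2)
  then show "A \<otimes>\<^bsub>Gamma0_2\<^esub> B \<in> carrier Gamma0_2"
    using AB by (cases A rule: mat2_cases; cases B rule: mat2_cases) auto
  show "\<exists>A'\<in>carrier Gamma0_2. A' \<otimes>\<^bsub>Gamma0_2\<^esub> A = \<one>\<^bsub>Gamma0_2\<^esub>"
  proof (cases A rule: mat2_cases)
    case (1 a b c d)
    then show ?thesis
      using AB mat2_left_inverse[of a b c d] by (intro bexI[of _ "mat2 d (- b) (- c) a"]) (auto simp: algebra_simps)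
  qed
next
  show "\<one>\<^bsub>Gamma0_2\<^esub> \<in> carrier Gamma0_2" by (simp add: mat_1_eq_mat2)
qed (auto simp: matrix_mul_assoc)

interpretation Gamma0_2: group Gamma0_2
  rewrites "monoid.mult Gamma0_2 = (**)" and "one Gamma0_2 = mat 1"
  using group_Gamma0_2 by (simp_all add: Gamma0_2_def)

lemma T_mat_in_Gamma0_2: "T_mat \<in> carrier Gamma0_2" and X_mat_in_Gamma0_2: "X_mat \<in> carrier Gamma0_2"
  by (simp_all add: T_mat_eq_mat2 X_mat_eq_mat2)

lemma inv_T_mat: "inv\<^bsub>Gamma0_2\<^esub> T_mat = mat2 1 (-1) 0 1"
  by (rule Gamma0_2.inv_equality) (simp_all add: T_mat_eq_mat2 mat_1_eq_mat2)

text \<open>Euclid's algorithm on the first column: \<open>a\<close> is odd and \<open>c\<close> is even, so one of them can always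
  be made smaller by \<open>T\<^sup>\<plusminus>\<^sup>1\<close> or by \<open>(X T)\<^sup>\<plusminus>\<^sup>1\<close>, which adds \<open>\<plusminus> 2 a\<close> to \<open>c\<close>.\<close>

lemma Gamma0_2_induct [consumes 1, case_names one T T_inv X]:
  assumes M: "M \<in> carrier Gamma0_2"
    and one: "P (mat 1)"
    and T: "\<And>A. A \<in> carrier Gamma0_2 \<Longrightarrow> P A \<Longrightarrow> P (T_mat ** A)"
    and Ti: "\<And>A. A \<in> carrier Gamma0_2 \<Longrightarrow> P A \<Longrightarrow> P (inv\<^bsub>Gamma0_2\<^esub> T_mat ** A)"
    and X: "\<And>A. A \<in> carrier Gamma0_2 \<Longrightarrow> P A \<Longrightarrow> P (X_mat ** A)"
  shows "P M"
proof -
  have T': "P (mat2 (a + c) (b + d) c d)" and Ti': "P (mat2 (a - c) (b - d) c d)"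
    and X': "P (mat2 (a - c) (b - d) (2 * a - c) (2 * b - d))"
    if "P (mat2 a b c d)" "a * d - b * c = 1" "even c" for a b c d
    using T[of "mat2 a b c d"] Ti[of "mat2 a b c d", unfolded inv_T_mat] X[of "mat2 a b c d"] that
    by (simp_all add: T_mat_eq_mat2 X_mat_eq_mat2)
  \<comment> \<open>The square of \<open>X_mat\<close> is minus the identity.\<close>
  have neg: "P (mat2 (- a) (- b) (- c) (- d))" if "P (mat2 a b c d)" "a * d - b * c = 1" "even c" for a b c d
    using X'[OF X'[OF that]] that by (simp add: algebra_simps)
  \<comment> \<open>Left multiplication by \<open>X T\<close>; the next fact is its inverse, formed
    with \<open>- X\<close> as the inverse of \<open>X\<close>.\<close>
  have Y: "P (mat2 a b (c + 2 * a) (d + 2 * b))" if "P (mat2 a b c d)" "a * d - b * c = 1" "even c" for a b c d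
    using X'[OF T'[OF that]] that by (simp add: algebra_simps)
  have Yi: "P (mat2 a b (c - 2 * a) (d - 2 * b))" if "P (mat2 a b c d)" "a * d - b * c = 1" "even c" for a b c d
    using Ti'[OF neg[OF X'[OF that]]] that by (simp add: algebra_simps)
  have unip: "P (mat2 1 b 0 1)" for b
  proof (induction b rule: int_induct[where k = 0])
    case base
    show ?case using one by (simp add: mat_1_eq_mat2)
  next
    case (step1 b)
    then show ?case using T'[of 1 b 0 1] by simp
  next
    case (step2 b)
    then show ?case using Ti'[of 1 b 0 1] by simp
  qed
  have "P (mat2 a b c d)" if "a * d - b * c = 1" "even c" for a b c d
    using that
  proof (induction "nat (\<bar>a\<bar> + \<bar>c\<bar>)" arbitrary: a b c d rule: less_induct)
    case less
    have "odd a" using less.prems by (metis dvd_diff dvd_mult dvd_mult2 odd_one)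
    \<comment> \<open>Parity excludes \<open>\<bar>a\<bar> = \<bar>c\<bar>\<close>, so one of the
      two entries can always be reduced by the other.\<close>
    consider "c = 0" | "c \<noteq> 0" "\<bar>c\<bar> < \<bar>a\<bar>" | "c \<noteq> 0" "\<bar>a\<bar> < \<bar>c\<bar>"
      using \<open>odd a\<close> \<open>even c\<close> by (metis abs_eq_iff dvd_minus_iff linorder_neqE)
    then show ?case
    proof cases
      case 1
      then have "a * d = 1" using less.prems by simp
      then consider "a = 1" "d = 1" | "a = -1" "d = -1" by (auto simp: zmult_eq_1_iff)
      then show ?thesis
        using 1 unip[of b] neg[OF unip[of "-b"]] by cases auto
    next
      case 2
      show ?thesis
      proof (cases "a * c > 0")
        case True
        then have "nat (\<bar>a - c\<bar> + \<bar>c\<bar>) < nat (\<bar>a\<bar> + \<bar>c\<bar>)" using 2 by (auto simp: zero_less_mult_iff)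
        from T'[OF less.hyps[OF this, of "d" "b - d"]] show ?thesis
          using less.prems by (simp add: algebra_simps)
      next
        case False
        then have "nat (\<bar>a + c\<bar> + \<bar>c\<bar>) < nat (\<bar>a\<bar> + \<bar>c\<bar>)" using 2 by (auto simp: zero_less_mult_iff not_less)
        from Ti'[OF less.hyps[OF this, of "d" "b + d"]] show ?thesis
          using less.prems by (simp add: algebra_simps)
      qed
    next
      case 3
      have "a \<noteq> 0" using \<open>odd a\<close> by auto
      show ?thesis
      proof (cases "a * c > 0")
        case True
        then have "nat (\<bar>a\<bar> + \<bar>c - 2 * a\<bar>) < nat (\<bar>a\<bar> + \<bar>c\<bar>)" using 3 by (auto simp: zero_less_mult_iff)
        from Y[OF less.hyps[OF this, of "d - 2 * b" "b"]] show ?thesis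
          using less.prems by (simp add: algebra_simps)
      next
        case False
        then have "nat (\<bar>a\<bar> + \<bar>c + 2 * a\<bar>) < nat (\<bar>a\<bar> + \<bar>c\<bar>)"
          using 3 \<open>a \<noteq> 0\<close> by (auto simp: zero_less_mult_iff not_less)
        from Yi[OF less.hyps[OF this, of "d + 2 * b" "b"]] show ?thesis
          using less.prems by (simp add: algebra_simps)
      qed
    qed
  qed
  then show ?thesis using M by (cases M rule: mat2_cases) auto
qed

section \<open>The Moebius action and its automorphy factor\<close>

lemma Im_autom_times:
  "Im ((of_int a * \<tau> + of_int b) * cnj (of_int c * \<tau> + of_int d)) = of_int (a * d - b * c) * Im \<tau>"
  by (simp add: algebra_simps)

lemma autom_nonzero:
  assumes "det A = 1" "Im \<tau> > 0"
  shows "autom A \<tau> \<noteq> 0"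
proof
  assume "autom A \<tau> = 0"
  then have "of_int (A$1$1 * A$2$2 - A$1$2 * A$2$1) * Im \<tau> = 0"
    unfolding Im_autom_times[symmetric] autom_def by simp
  moreover have "A$1$1 * A$2$2 - A$1$2 * A$2$1 = 1" using assms by (simp add: det_2)
  ultimately show False using assms by simp
qed

lemma Im_moebius_act:
  assumes "det A = 1" "Im \<tau> > 0"
  shows "Im (moebius_act A \<tau>) = Im \<tau> / norm (autom A \<tau>) ^ 2"
proof -
  have "moebius_act A \<tau> = (of_int (A$1$1) * \<tau> + of_int (A$1$2)) * cnj (of_int (A$2$1) * \<tau> + of_int (A$2$2)) / of_real (norm (autom A \<tau>) ^ 2)"
    unfolding moebius_act_def autom_def by (rule complex_div_cnj)
  then have "Im (moebius_act A \<tau>) = of_int (A$1$1 * A$2$2 - A$1$2 * A$2$1) * Im \<tau> / norm (autom A \<tau>) ^ 2"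
    by (simp only: Im_divide_of_real Im_autom_times)
  also have "A$1$1 * A$2$2 - A$1$2 * A$2$1 = 1" using assms by (simp add: det_2)
  finally show ?thesis by simp
qed

lemma Im_moebius_act_pos: "det A = 1 \<Longrightarrow> Im \<tau> > 0 \<Longrightarrow> Im (moebius_act A \<tau>) > 0"
  using Im_moebius_act[of A \<tau>] autom_nonzero[of A \<tau>] by simp

lemma autom_mult:
  assumes "det B = 1" "Im \<tau> > 0"
  shows "autom (A ** B) \<tau> = autom A (moebius_act B \<tau>) * autom B \<tau>"
proof (cases A rule: mat2_cases; cases B rule: mat2_cases)
  fix a b c d a' b' c' d' assume AB: "A = mat2 a b c d" "B = mat2 a' b' c' d'"
  show ?thesis
    using autom_nonzero[OF assms] by (simp add: AB autom_def moebius_act_def field_simps)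
qed

lemma moebius_act_mult:
  assumes "det A = 1" "det B = 1" "Im \<tau> > 0"
  shows "moebius_act (A ** B) \<tau> = moebius_act A (moebius_act B \<tau>)"
proof (cases A rule: mat2_cases; cases B rule: mat2_cases)
  fix a b c d a' b' c' d' assume AB: "A = mat2 a b c d" "B = mat2 a' b' c' d'"
  let ?n = "of_int a' * \<tau> + of_int b'" and ?m = "of_int c' * \<tau> + of_int d'"
  have nz: "?m \<noteq> 0" using autom_nonzero[OF assms(2,3)] by (simp add: AB autom_def)
  have clear: "(x * (?n / m) + y) * m = x * ?n + y * m" if "m \<noteq> 0" for x y m
    using that by (simp add: field_simps)
  have "moebius_act A (moebius_act B \<tau>) = ((of_int a * (?n / ?m) + of_int b) * ?m) / ((of_int c * (?n / ?m) + of_int d) * ?m)"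
    using nz by (simp add: AB moebius_act_def)
  also have "\<dots> = (of_int a * ?n + of_int b * ?m) / (of_int c * ?n + of_int d * ?m)"
    by (simp only: clear[OF nz])
  also have "\<dots> = moebius_act (A ** B) \<tau>" by (simp add: AB moebius_act_def algebra_simps)
  finally show ?thesis ..
qed

lemma moebius_act_1 [simp]: "moebius_act (mat 1) \<tau> = \<tau>" and autom_1 [simp]: "autom (mat 1) \<tau> = 1"
  by (simp_all add: mat_1_eq_mat2 moebius_act_def autom_def)

lemma moebius_act_T: "moebius_act T_mat \<tau> = \<tau> + 1" and autom_T: "autom T_mat \<tau> = 1"
  and moebius_act_X: "moebius_act X_mat \<tau> = (\<tau> - 1) / (2 * \<tau> - 1)" and autom_X: "autom X_mat \<tau> = 2 * \<tau> - 1"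
  by (simp_all add: T_mat_eq_mat2 X_mat_eq_mat2 moebius_act_def autom_def)

lemma moebius_act_inv:
  assumes "A \<in> carrier Gamma0_2" "Im \<tau> > 0"
  shows "moebius_act A (moebius_act (inv\<^bsub>Gamma0_2\<^esub> A) \<tau>) = \<tau>"
  using moebius_act_mult[of A "inv\<^bsub>Gamma0_2\<^esub> A" \<tau>] assms by (simp add: det_Gamma0_2)


subsection \<open>The two characters\<close>

text \<open>The integer power \<open>\<i>^b\<close>, in exponential form so that it can be compared
  with exponentials of logarithms.\<close>

definition fourth_root :: "int \<Rightarrow> complex" where
  "fourth_root b = exp (of_int b * (of_real pi * \<i> / 2))"

lemma fourth_root_add: "fourth_root (a + b) = fourth_root a * fourth_root b"
  unfolding fourth_root_def of_int_add distrib_right exp_add ..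

lemma fourth_root_0 [simp]: "fourth_root 0 = 1"
  by (simp add: fourth_root_def)

lemma fourth_root_eq_iff: "fourth_root a = fourth_root b \<longleftrightarrow> a mod 4 = b mod 4"
proof -
  have "fourth_root a = fourth_root b \<longleftrightarrow> (\<exists>n. a = b + 4 * n)"
  proof -
    have "of_int a * (of_real pi * \<i> / 2) = of_int b * (of_real pi * \<i> / 2) + of_real (of_int (2 * n) * pi) * \<i> \<longleftrightarrow> a = b + 4 * n"
      for n :: int
    proof -
      have "of_int b * (of_real pi * \<i> / 2) + of_real (of_int (2 * n) * pi) * \<i> = of_int (b + 4 * n) * (of_real pi * \<i> / 2)"
        by (simp add: field_simps)
      then show ?thesis by (simp only: mult_cancel_right of_int_eq_iff) simp
    qed
    then show ?thesis unfolding fourth_root_def exp_eq by simp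
  qed
  also have "\<dots> \<longleftrightarrow> a mod 4 = b mod 4" by presburger
  finally show ?thesis .
qed

text \<open>The function \<open>exp (log_Delta_Z4 \<tau> / 4)\<close> is a fourth root of \<open>\<Delta>\<close>, of weight \<open>- 1\<close>; since
  \<open>c \<tau> + d\<close> is an honest cocycle, its multiplier is a character, of order 4.\<close>

definition has_multiplier :: "int^2^2 \<Rightarrow> int \<Rightarrow> int \<Rightarrow> bool" where
  "has_multiplier M a b \<longleftrightarrow> (\<forall>\<tau>\<in>upper_half_plane.
     log_Delta_Z (moebius_act M \<tau>) = log_Delta_Z \<tau> + 2 * of_real pi * \<i> * of_int a \<and>
     exp (log_Delta_Z4 (moebius_act M \<tau>) / 4) * autom M \<tau> =
       exp (log_Delta_Z4 \<tau> / 4) * fourth_root b)"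

lemma has_multiplier_mult:
  assumes "A \<in> carrier Gamma0_2" "B \<in> carrier Gamma0_2" "has_multiplier A a b" "has_multiplier B a' b'"
  shows "has_multiplier (A ** B) (a + a') (b + b')"
  unfolding has_multiplier_def
proof (intro ballI conjI)
  fix \<tau> :: complex assume "\<tau> \<in> upper_half_plane"
  then have \<tau>: "Im \<tau> > 0" by simp
  have B\<tau>: "Im (moebius_act B \<tau>) > 0" using assms \<tau> by (intro Im_moebius_act_pos) (auto simp: det_Gamma0_2)
  have AB: "moebius_act (A ** B) \<tau> = moebius_act A (moebius_act B \<tau>)"
    "autom (A ** B) \<tau> = autom A (moebius_act B \<tau>) * autom B \<tau>"
    using assms \<tau> by (auto simp: moebius_act_mult autom_mult det_Gamma0_2)
  show "log_Delta_Z (moebius_act (A ** B) \<tau>) = log_Delta_Z \<tau> + 2 * of_real pi * \<i> * of_int (a + a')"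
    using assms(3,4) \<tau> B\<tau> unfolding AB has_multiplier_def by (auto simp: algebra_simps)
  have "exp (log_Delta_Z4 (moebius_act (A ** B) \<tau>) / 4) * autom (A ** B) \<tau> =
      exp (log_Delta_Z4 (moebius_act A (moebius_act B \<tau>)) / 4) * autom A (moebius_act B \<tau>) * autom B \<tau>"
    unfolding AB by simp
  also have "\<dots> = exp (log_Delta_Z4 (moebius_act B \<tau>) / 4) * autom B \<tau> * fourth_root b"
    using assms(3) B\<tau> unfolding has_multiplier_def by simp
  also have "\<dots> = exp (log_Delta_Z4 \<tau> / 4) * (fourth_root b' * fourth_root b)"
    using assms(4) \<tau> unfolding has_multiplier_def by simp
  also have "fourth_root b' * fourth_root b =
      fourth_root (b + b')"
    by (simp add: fourth_root_add)
  finally show "exp (log_Delta_Z4 (moebius_act (A ** B) \<tau>) / 4) * autom (A ** B) \<tau> =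
      exp (log_Delta_Z4 \<tau> / 4) * fourth_root (b + b')" .
qed

lemma has_multiplier_1: "has_multiplier (mat 1) 0 0"
  by (simp add: has_multiplier_def)

lemma has_multiplier_T: "has_multiplier T_mat 1 0"
  by (simp add: has_multiplier_def moebius_act_T autom_T log_Delta_Z_plus_1 log_Delta_Z4_plus_1)

lemma has_multiplier_X: "has_multiplier X_mat 0 1"
proof -
  have "exp ((l + 2 * of_real pi * \<i> - 4 * Ln w) / 4) * w = exp (l / 4) * fourth_root 1"
    if "w \<noteq> 0" for l w :: complex
  proof -
    \<comment> \<open>A quarter of \<open>2 * pi * \<i>\<close> survives: \<open>X\<close> has
      multiplier \<open>\<i>\<close>, of order 4.\<close>
    have "(l + 2 * of_real pi * \<i> - 4 * Ln w) / 4 = l / 4 + of_real pi * \<i> / 2 - Ln w"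
      by (simp add: field_simps)
    then show ?thesis using that by (simp only: exp_diff exp_add exp_Ln fourth_root_def) simp
  qed
  moreover have "2 * \<tau> - 1 \<noteq> 0" if "Im \<tau> > 0" for \<tau>
    using that by (metis Im_complex_of_real diff_add_cancel add_0 complex_Im_numeral less_irrefl
      mult_eq_0_iff nonzero_mult_div_cancel_left of_real_1 of_real_divide of_real_numeral zero_neq_numeral)
  ultimately show ?thesis
    by (simp add: has_multiplier_def moebius_act_X autom_X log_Delta_Z_X log_Delta_Z4_X)
qed

lemma has_multiplier_inv:
  assumes A: "A \<in> carrier Gamma0_2" "has_multiplier A a b"
  shows "has_multiplier (inv\<^bsub>Gamma0_2\<^esub> A) (- a) (- b)"
  unfolding has_multiplier_def
proof (intro ballI conjI)
  fix \<tau> :: complex assume "\<tau> \<in> upper_half_plane"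
  then have \<tau>: "Im \<tau> > 0" by simp
  let ?B = "inv\<^bsub>Gamma0_2\<^esub> A"
  define \<sigma> where "\<sigma> = moebius_act ?B \<tau>"
  have B: "?B \<in> carrier Gamma0_2" using A by simp
  have \<sigma>: "Im \<sigma> > 0" unfolding \<sigma>_def using B \<tau> by (intro Im_moebius_act_pos) (auto simp: det_Gamma0_2)
  have A\<sigma>: "moebius_act A \<sigma> = \<tau>" unfolding \<sigma>_def by (rule moebius_act_inv[OF A(1) \<tau>])
  have "autom (A ** ?B) \<tau> = autom A \<sigma> * autom ?B \<tau>"
    unfolding \<sigma>_def using B \<tau> by (intro autom_mult) (auto simp: det_Gamma0_2)
  then have au: "autom A \<sigma> * autom ?B \<tau> = 1" using A by simp
  have t: "log_Delta_Z \<tau> = log_Delta_Z \<sigma> + 2 * of_real pi * \<i> * of_int a"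
    "exp (log_Delta_Z4 \<tau> / 4) * autom A \<sigma> = exp (log_Delta_Z4 \<sigma> / 4) * fourth_root b"
    using A(2) \<sigma> unfolding has_multiplier_def A\<sigma>[symmetric] by (auto simp: A\<sigma>)
  show "log_Delta_Z (moebius_act ?B \<tau>) = log_Delta_Z \<tau> + 2 * of_real pi * \<i> * of_int (- a)"
    unfolding \<sigma>_def[symmetric] t by simp
  have "exp (log_Delta_Z4 \<sigma> / 4) * autom ?B \<tau> = exp (log_Delta_Z4 \<sigma> / 4) *
     (fourth_root b * fourth_root (- b)) * autom ?B \<tau>"
    by (simp flip: fourth_root_add)
  also have "\<dots> = exp (log_Delta_Z4 \<tau> / 4) * (autom A \<sigma> * autom ?B \<tau>) * fourth_root (- b)"
    unfolding mult.assoc[symmetric] t(2)[symmetric] by (simp only: mult_ac)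
  finally show "exp (log_Delta_Z4 (moebius_act ?B \<tau>) / 4) * autom ?B \<tau> =
      exp (log_Delta_Z4 \<tau> / 4) * fourth_root (- b)"
    unfolding \<sigma>_def[symmetric] au by simp
qed

text \<open>Having a multiplier is inherited by products and inverses, so it suffices to know it for
  the generators.\<close>

lemma has_multiplier_exists:
  assumes "M \<in> carrier Gamma0_2"
  shows "\<exists>a b. has_multiplier M a b"
  using assms
proof (induction rule: Gamma0_2_induct)
  case one
  show ?case using has_multiplier_1 by blast
next
  case (T A)
  then show ?case using has_multiplier_mult[OF T_mat_in_Gamma0_2 _ has_multiplier_T] by blast
next
  case (T_inv A)
  then show ?case
    using has_multiplier_mult[OF _ _ has_multiplier_inv[OF T_mat_in_Gamma0_2 has_multiplier_T]] T_mat_in_Gamma0_2 by blast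
next
  case (X A)
  then show ?case using has_multiplier_mult[OF X_mat_in_Gamma0_2 _ has_multiplier_X] by blast
qed

lemma has_multiplier_unique:
  assumes "has_multiplier M a b" "has_multiplier M a' b'"
  shows "a = a'" "b mod 4 = b' mod 4"
proof -
  have "2 * of_real pi * \<i> * of_int a = 2 * of_real pi * \<i> * (of_int a' :: complex)"
    using assms unfolding has_multiplier_def by (metis (no_types, lifting) add_left_cancel imaginary_unit.sel(2) mem_Collect_eq zero_less_one)
  then show "a = a'" by simp
  have "exp (log_Delta_Z4 \<i> / 4) * fourth_root b = exp (log_Delta_Z4 \<i> / 4) * fourth_root b'"
    using assms unfolding has_multiplier_def by (metis (no_types, lifting) imaginary_unit.sel(2) mem_Collect_eq zero_less_one)
  then show "b mod 4 = b' mod 4" by (simp add: fourth_root_eq_iff)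
qed

lemma has_multiplier_mod: "has_multiplier M a b \<Longrightarrow> has_multiplier M a (b mod 4)"
  using fourth_root_eq_iff[of "b mod 4" b] unfolding has_multiplier_def by simp

definition qZ :: "int^2^2 \<Rightarrow> int" where
  "qZ M = (THE a. \<exists>b. has_multiplier M a b)"

text \<open>The representative in \<open>{0..<4}\<close> is the one that makes up the carrier of
  \<open>integer_mod_group 4\<close>.\<close>

definition qZ4 :: "int^2^2 \<Rightarrow> int" where
  "qZ4 M = (THE b. b \<in> {0..<4} \<and> (\<exists>a. has_multiplier M a b))"

lemma q_eqI:
  assumes "has_multiplier M a b"
  shows "qZ M = a" "qZ4 M = b mod 4"
proof -
  show "qZ M = a"
    unfolding qZ_def using assms has_multiplier_unique(1) by (intro the_equality) blast+
  show "qZ4 M = b mod 4"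
    unfolding qZ4_def
  proof (rule the_equality)
    show "b mod 4 \<in> {0..<4} \<and> (\<exists>a. has_multiplier M a (b mod 4))"
      using has_multiplier_mod[OF assms] by auto
  next
    fix b' assume b': "b' \<in> {0..<4} \<and> (\<exists>a. has_multiplier M a b')"
    then have "b' mod 4 = b mod 4" using assms has_multiplier_unique(2) by blast
    then show "b' = b mod 4" using b' by simp
  qed
qed

lemma has_multiplier_q: "M \<in> carrier Gamma0_2 \<Longrightarrow> has_multiplier M (qZ M) (qZ4 M)"
  using has_multiplier_exists[of M] has_multiplier_mod by (auto simp: q_eqI)

lemma qZ4_range: "M \<in> carrier Gamma0_2 \<Longrightarrow> qZ4 M \<in> {0..<4}"
  using has_multiplier_exists[of M] by (auto simp: q_eqI)

lemma q_mult:
  assumes "A \<in> carrier Gamma0_2" "B \<in> carrier Gamma0_2"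
  shows "qZ (A ** B) = qZ A + qZ B" "qZ4 (A ** B) = (qZ4 A + qZ4 B) mod 4"
  using q_eqI[OF has_multiplier_mult[OF assms has_multiplier_q has_multiplier_q]] assms by auto

lemma q_inv:
  assumes "A \<in> carrier Gamma0_2"
  shows "qZ (inv\<^bsub>Gamma0_2\<^esub> A) = - qZ A" "qZ4 (inv\<^bsub>Gamma0_2\<^esub> A) = (- qZ4 A) mod 4"
  using q_eqI[OF has_multiplier_inv[OF assms has_multiplier_q[OF assms]]] by auto

lemma q_generators: "qZ (mat 1) = 0" "qZ4 (mat 1) = 0" "qZ T_mat = 1" "qZ4 T_mat = 0" "qZ X_mat = 0" "qZ4 X_mat = 1"
  using q_eqI[OF has_multiplier_1] q_eqI[OF has_multiplier_T] q_eqI[OF has_multiplier_X] by auto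

lemma log_branch_Delta_Z_moebius:
  assumes L: "log_branch Delta_Z L" and M: "M \<in> carrier Gamma0_2" and \<tau>: "Im \<tau> > 0"
  shows "L (moebius_act M \<tau>) = L \<tau> + 2 * of_real pi * \<i> * of_int (qZ M)"
proof -
  obtain k where k: "\<And>\<tau>. Im \<tau> > 0 \<Longrightarrow> L \<tau> = log_Delta_Z \<tau> + 2 * of_real pi * \<i> * of_int k"
    using log_branch_unique[OF L log_branch_log_Delta_Z] by blast
  show ?thesis
    using has_multiplier_q[OF M] \<tau> Im_moebius_act_pos[OF det_Gamma0_2[OF M] \<tau>]
    unfolding has_multiplier_def by (simp add: k)
qed

lemma log_branch_Delta_Z4_moebius:
  assumes L: "log_branch Delta_Z4 L" and M: "M \<in> carrier Gamma0_2" and \<tau>: "Im \<tau> > 0"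
    and \<phi>: "exp \<phi> = autom M \<tau>"
  obtains k where "L (moebius_act M \<tau>) = L \<tau> - 4 * \<phi> + 2 * of_real pi * \<i> * of_int k" "k mod 4 = qZ4 M"
proof -
  obtain k where k: "\<And>\<tau>. Im \<tau> > 0 \<Longrightarrow> L \<tau> = log_Delta_Z4 \<tau> + 2 * of_real pi * \<i> * of_int k"
    using log_branch_unique[OF L log_branch_log_Delta_Z4] by blast
  \<comment> \<open>Equality of these exponentials fixes the exponents up to
    \<open>2 * pi * \<i>\<close>; undoing the division by 4 multiplies this ambiguity by 4, for
    every choice of \<open>\<phi>\<close>.\<close>
  have "exp (log_Delta_Z4 (moebius_act M \<tau>) / 4 + \<phi>) = exp (log_Delta_Z4 \<tau> / 4 + of_int (qZ4 M) * (of_real pi * \<i> / 2))"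
    using has_multiplier_q[OF M] \<tau> unfolding has_multiplier_def exp_add \<phi> fourth_root_def by simp
  then obtain n where "log_Delta_Z4 (moebius_act M \<tau>) / 4 + \<phi> =
      log_Delta_Z4 \<tau> / 4 + of_int (qZ4 M) * (of_real pi * \<i> / 2) + of_real (of_int (2 * n) * pi) * \<i>"
    unfolding exp_eq by blast
  moreover have "log_Delta_Z4 (moebius_act M \<tau>) = 4 * (log_Delta_Z4 (moebius_act M \<tau>) / 4 + \<phi>) - 4 * \<phi>"
    by simp
  ultimately have "log_Delta_Z4 (moebius_act M \<tau>) =
      log_Delta_Z4 \<tau> - 4 * \<phi> + 2 * of_real pi * \<i> * of_int (qZ4 M + 4 * n)"
    by (simp only:) (simp add: algebra_simps)
  moreover have "(qZ4 M + 4 * n) mod 4 = qZ4 M" using qZ4_range[OF M] by simp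
  ultimately show thesis
    using \<tau> Im_moebius_act_pos[OF det_Gamma0_2[OF M] \<tau>] by (intro that[of "qZ4 M + 4 * n"]) (auto simp: k)
qed


subsection \<open>Charges of loops\<close>

lemma sum_int_Suc:
  fixes h :: "int \<Rightarrow> 'a::comm_monoid_add"
  shows "(\<Sum>i=1..int (Suc k). h i) = (\<Sum>i=1..int k. h i) + h (int (Suc k))"
proof -
  have "{1..int (Suc k)} = insert (int (Suc k)) {1..int k}" by auto
  then show ?thesis by (simp add: add.commute)
qed

lemma sum_int_shift:
  fixes h :: "int \<Rightarrow> 'a::ab_group_add"
  assumes "h (int n + 1) = h 1"
  shows "(\<Sum>i=1..int n. h (i + 1)) = (\<Sum>i=1..int n. h i)"
proof -
  have "(\<Sum>i=1..int k. h (i + 1)) - (\<Sum>i=1..int k. h i) = h (int k + 1) - h 1" for k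
    by (induction k) (simp_all only: sum_int_Suc, simp_all add: algebra_simps)
  from this[of n] show ?thesis using assms by simp
qed

lemma seg_integral_eq:
  assumes D: "is_loop_field D" and L: "L holomorphic_on upper_half_plane"
  shows "seg_integral L D i = L (fld D i (cut D i)) - L (fld D i (cut D (i - 1)))"
proof -
  have le: "cut D (i - 1) \<le> cut D i" and uhp: "fld D i ` segment D i \<subseteq> upper_half_plane"
    and pw: "fld D i piecewise_C1_differentiable_on segment D i"
    using D unfolding is_loop_field_def by (auto intro: less_imp_le)
  obtain S where S: "finite S" "fld D i C1_differentiable_on (segment D i - S)" and cont: "continuous_on (segment D i) (fld D i)"
    using pw unfolding piecewise_C1_differentiable_on_def by blast
  have "((\<lambda>s. dlog L (fld D i) s 1) has_integral L (fld D i (cut D i)) - L (fld D i (cut D (i - 1)))) {cut D (i - 1)..cut D i}"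
  \<comment> \<open>Only continuity is required at the finitely many points where the field is not
    differentiable.\<close>
  proof (rule fundamental_theorem_of_calculus_interior_strong[OF S(1) le])
    fix s assume s: "s \<in> {cut D (i - 1)<..<cut D i} - S"
    then have "s \<in> segment D i - S" by (auto simp: segment_def)
    then have "fld D i differentiable (at s)"
      using S(2) unfolding C1_differentiable_on_eq by blast
    moreover have "fld D i s \<in> upper_half_plane" using uhp \<open>s \<in> segment D i - S\<close> by blast
    then have "L field_differentiable (at (fld D i s))"
      using L holomorphic_on_imp_differentiable_at[OF _ open_halfspace_Im_gt] by blast
    then have "L differentiable (at (fld D i s))" by (rule field_differentiable_imp_differentiable)
    ultimately have d: "(\<lambda>s. L (fld D i s)) differentiable (at s)"
      using differentiable_chain_at[of "fld D i" s L] unfolding o_def by blast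
    have "dlog L (fld D i) s 1 = vector_derivative (\<lambda>s. L (fld D i s)) (at s)"
      unfolding dlog_def frechet_derivative_eq_vector_derivative[OF d] by simp
    then show "((\<lambda>s. L (fld D i s)) has_vector_derivative dlog L (fld D i) s 1) (at s)"
      using d vector_derivative_works[of "\<lambda>s. L (fld D i s)"] by simp
  next
    show "continuous_on {cut D (i - 1)..cut D i} (\<lambda>s. L (fld D i s))"
      using continuous_on_compose2[OF holomorphic_on_imp_continuous_on[OF L] cont uhp] by (simp add: segment_def)
  qed
  then show ?thesis unfolding seg_integral_def segment_def by (rule integral_unique)
qed

lemma loop_field_jump:
  assumes D: "is_loop_field D"
  shows "fld D (i + 1) (cut D (i + 1 - 1)) = moebius_act (trans D i) (fld D i (cut D i))"
    "trans D i \<in> carrier Gamma0_2" "Im (fld D i (cut D i)) > 0"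
    "fld D (i + int (nseg D)) (cut D (i + int (nseg D) - 1)) = fld D i (cut D (i - 1))"
proof -
  have le: "cut D (i - 1) \<le> cut D i"
    using D unfolding is_loop_field_def by (auto intro: less_imp_le)
  then have mem: "cut D i \<in> segment D i" "cut D (i - 1) \<in> segment D i" by (auto simp: segment_def)
  show "fld D (i + 1) (cut D (i + 1 - 1)) = moebius_act (trans D i) (fld D i (cut D i))"
    "trans D i \<in> carrier Gamma0_2"
    using D unfolding is_loop_field_def by auto
  have "fld D i ` segment D i \<subseteq> upper_half_plane" using D unfolding is_loop_field_def by blast
  then show "Im (fld D i (cut D i)) > 0" using mem by blast
  have "cut D (i - 1 + int (nseg D)) = cut D (i - 1) + 1"
    and "fld D (i + int (nseg D)) (cut D (i - 1) + 1) = fld D i (cut D (i - 1))"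
    using D mem unfolding is_loop_field_def by blast+
  then show "fld D (i + int (nseg D)) (cut D (i + int (nseg D) - 1)) = fld D i (cut D (i - 1))"
    by (simp add: algebra_simps)
qed

text \<open>A cyclic shift of the initial values puts the start of segment \<open>i + 1\<close>
  beside the end of segment \<open>i\<close>, so each summand becomes the jump at
  \<open>cut D i\<close>. Periodicity closes the cycle.\<close>

lemma sum_seg_integral:
  assumes D: "is_loop_field D" and L: "L holomorphic_on upper_half_plane"
  shows "(\<Sum>i=1..int (nseg D). seg_integral L D i) =
    (\<Sum>i=1..int (nseg D). L (fld D i (cut D i)) - L (moebius_act (trans D i) (fld D i (cut D i))))"
proof -
  have "(\<Sum>i=1..int (nseg D). L (fld D (i + 1) (cut D (i + 1 - 1)))) = (\<Sum>i=1..int (nseg D). L (fld D i (cut D (i - 1))))"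
    using loop_field_jump(4)[OF D, of 1] by (intro sum_int_shift) (simp add: add.commute)
  then show ?thesis
    unfolding seg_integral_eq[OF D L] sum_subtractf loop_field_jump(1)[OF D] by simp
qed

text \<open>The targets are commutative, so the order of the transition functions is forgotten and
  the inverses become a minus sign.\<close>

lemma q_continuation:
  assumes D: "is_loop_field D"
  shows "continuation D k \<in> carrier Gamma0_2"
    and "qZ (continuation D k) = - (\<Sum>i=1..int k. qZ (trans D i))"
    and "qZ4 (continuation D k) = (- (\<Sum>i=1..int k. qZ4 (trans D i))) mod 4"
proof -
  have "continuation D k \<in> carrier Gamma0_2 \<and> qZ (continuation D k) = - (\<Sum>i=1..int k. qZ (trans D i)) \<and>
     qZ4 (continuation D k) = (- (\<Sum>i=1..int k. qZ4 (trans D i))) mod 4"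
  proof (induction k)
    case 0
    show ?case using Gamma0_2.one_closed by (simp add: q_generators)
  next
    case (Suc k)
    let ?M = "trans D (int (Suc k))"
    have M: "?M \<in> carrier Gamma0_2" by (rule loop_field_jump(2)[OF D])
    have "qZ4 (continuation D (Suc k)) = ((- (\<Sum>i=1..int k. qZ4 (trans D i))) mod 4 + (- qZ4 ?M) mod 4) mod 4"
      using Suc M by (simp add: q_mult q_inv)
    also have "\<dots> = (- (\<Sum>i=1..int (Suc k). qZ4 (trans D i))) mod 4"
      unfolding sum_int_Suc by (simp add: mod_add_eq)
    finally show ?case
      using Suc M unfolding sum_int_Suc by (simp add: q_mult q_inv)
  qed
  then show "continuation D k \<in> carrier Gamma0_2"
    "qZ (continuation D k) = - (\<Sum>i=1..int k. qZ (trans D i))"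
    "qZ4 (continuation D k) = (- (\<Sum>i=1..int k. qZ4 (trans D i))) mod 4"
    by blast+
qed

lemma charge_Z_eq:
  assumes L: "log_branch Delta_Z L" and D: "is_loop_field D"
  shows "charge_Z L D = of_int (qZ (monodromy D))"
proof -
  have "(\<Sum>i=1..int (nseg D). seg_integral L D i) = (\<Sum>i=1..int (nseg D). - (2 * of_real pi * \<i>) * of_int (qZ (trans D i)))"
    unfolding sum_seg_integral[OF D L[unfolded log_branch_def, THEN conjunct1]]
    using log_branch_Delta_Z_moebius[OF L] loop_field_jump(2,3)[OF D] by (intro sum.cong) auto
  also have "\<dots> = 2 * of_real pi * \<i> * of_int (qZ (monodromy D))"
    unfolding monodromy_def q_continuation[OF D] sum_distrib_left[symmetric] by simp
  finally show ?thesis unfolding charge_Z_def by simp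
qed

text \<open>Each transition contributes an exact integer of which only the residue is prescribed;
  the value may depend on \<open>\<phi>\<close>, the residue of the sum does not.\<close>

lemma charge_Z4_with_eq:
  assumes L: "log_branch Delta_Z4 L" and D: "is_loop_field D" and \<phi>: "log_choice D \<phi>"
  shows "\<exists>k::int. charge_Z4_with L \<phi> D = of_int k \<and> k mod 4 = qZ4 (monodromy D)"
proof -
  have "\<exists>k. L (moebius_act (trans D i) (fld D i (cut D i))) = L (fld D i (cut D i)) - 4 * \<phi> i + 2 * of_real pi * \<i> * of_int k \<and>
      k mod 4 = qZ4 (trans D i)" for i
    using log_branch_Delta_Z4_moebius[OF L loop_field_jump(2,3)[OF D]] \<phi> unfolding log_choice_def by metis
  then obtain k where k: "\<And>i. L (moebius_act (trans D i) (fld D i (cut D i))) = L (fld D i (cut D i)) - 4 * \<phi> i + 2 * of_real pi * \<i> * of_int (k i)"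
    "\<And>i. k i mod 4 = qZ4 (trans D i)" by metis
  let ?k = "- (\<Sum>i=1..int (nseg D). k i)"
  have "(\<Sum>i=1..int (nseg D). seg_integral L D i - 4 * \<phi> i) = (\<Sum>i=1..int (nseg D). - (2 * of_real pi * \<i>) * of_int (k i))"
    unfolding sum_subtractf[of "seg_integral L D"] sum_seg_integral[OF D L[unfolded log_branch_def, THEN conjunct1]]
    unfolding sum_subtractf[symmetric] k(1) by (intro sum.cong) auto
  also have "\<dots> = 2 * of_real pi * \<i> * of_int ?k"
    unfolding sum_distrib_left[symmetric] by simp
  finally have "charge_Z4_with L \<phi> D = of_int ?k" unfolding charge_Z4_with_def by simp
  moreover have "?k mod 4 = (- (\<Sum>i=1..int (nseg D). k i mod 4)) mod 4"
    by (metis mod_minus_eq mod_sum_eq)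
  then have "?k mod 4 = qZ4 (monodromy D)"
    unfolding monodromy_def q_continuation[OF D] k(2) .
  ultimately show ?thesis by blast
qed

lemma log_choice_F:
  assumes "is_loop_field D"
  shows "log_choice D (\<lambda>i. F (fld D i (cut D i)) (trans D i))"
  using autom_nonzero det_Gamma0_2 loop_field_jump(2,3)[OF assms] unfolding log_choice_def F_def by simp

section \<open>Independence of the segmented description\<close>

lemma sum_periodic_int:
  fixes h :: "int \<Rightarrow> int"
  assumes per: "\<And>j. h (j + int n) = h j"
  shows "(\<Sum>j\<in>{a..<a + int n}. h j) = (\<Sum>j=1..int n. h j)"
proof (cases "n = 0")
  case False
  have step: "(\<Sum>j\<in>{a+1..<a + 1 + int n}. h j) = (\<Sum>j\<in>{a..<a + int n}. h j)" for a
  proof -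
    have "{a+1..<a + 1 + int n} = insert (a + int n) {a+1..<a + int n}" "{a..<a + int n} = insert a {a+1..<a + int n}"
      using False by auto
    then show ?thesis using per[of a] by simp
  qed
  have "(\<Sum>j\<in>{a..<a + int n}. h j) = (\<Sum>j\<in>{1..<1 + int n}. h j)"
  proof (induction a rule: int_induct[where k = 1])
    case (step1 a) then show ?case using step[of a] by simp
  next
    case (step2 a) then show ?case using step[of "a - 1"] by simp
  qed simp
  moreover have "{1..<1 + int n} = {1..int n}" by auto
  ultimately show ?thesis by simp
qed simp

lemma strict_mono_cut:
  assumes "is_loop_field D"
  shows "strict_mono (cut D)"
proof (rule strict_monoI)
  have s: "cut D (i - 1) < cut D i" for i using assms unfolding is_loop_field_def by blast
  fix x y :: int assume "x < y"
  then show "cut D x < cut D y"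
    by (induction y rule: int_gr_induct) (use s[of "x + 1"] s[of "_ + 1"] in \<open>auto intro: less_trans\<close>)
qed

lemma cut_periodic:
  assumes "is_loop_field D"
  shows "cut D (i + k * int (nseg D)) = cut D i + of_int k"
proof -
  have p: "cut D (i + int (nseg D)) = cut D i + 1" for i using assms unfolding is_loop_field_def by blast
  show ?thesis
  proof (induction k rule: int_induct[where k = 0])
    case (step1 k) then show ?case using p[of "i + k * int (nseg D)"] by (simp add: algebra_simps)
  next
    case (step2 k) then show ?case using p[of "i + (k - 1) * int (nseg D)"] by (simp add: algebra_simps)
  qed simp
qed

lemma cut_cover:
  assumes D: "is_loop_field D"
  shows "\<exists>!j. cut D (j - 1) < x \<and> x \<le> cut D j"
proof -
  \<comment> \<open>The number of whole turns before \<open>x\<close>. Ceiling minus one, and not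
    floor, because the segments are taken open on the left, so a cut point counts to the segment
    that it ends.\<close>
  define k where "k = \<lceil>x - cut D 0\<rceil> - 1"
  have k: "cut D (k * int (nseg D)) < x" "x \<le> cut D (k * int (nseg D) + int (nseg D))"
    using cut_periodic[OF D, of 0 k] cut_periodic[OF D, of 0 "k + 1"] unfolding k_def
    by (simp_all add: algebra_simps) linarith+
  define m where "m = (LEAST m::nat. x \<le> cut D (k * int (nseg D) + int m))"
  have m: "x \<le> cut D (k * int (nseg D) + int m)" unfolding m_def using k(2) by (rule LeastI)
  have "m \<noteq> 0"
  proof
    assume "m = 0"
    then show False using m k(1) by simp
  qed
  moreover have "\<not> x \<le> cut D (k * int (nseg D) + int (m - 1))"
    using \<open>m \<noteq> 0\<close> by (intro not_less_Least[of "m - 1", folded m_def]) (simp add: m_def)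
  ultimately have ex: "cut D (k * int (nseg D) + int m - 1) < x"
    by (simp add: of_nat_diff algebra_simps)
  show ?thesis
  proof (rule ex1I)
    show "cut D (k * int (nseg D) + int m - 1) < x \<and> x \<le> cut D (k * int (nseg D) + int m)" using ex m by blast
  next
    fix j assume j: "cut D (j - 1) < x \<and> x \<le> cut D j"
    have "cut D (j - 1) < cut D (k * int (nseg D) + int m)" "cut D (k * int (nseg D) + int m - 1) < cut D j"
      using j ex m by linarith+
    then show "j = k * int (nseg D) + int m"
      using strict_mono_less[OF strict_mono_cut[OF D]] by force
  qed
qed

text \<open>Walk through the common refinement of the two segmentations: along it
  \<open>f (g i j)\<close> changes by \<open>- f (M\<^sub>i)\<close> when the first index advances and by \<open>f (M'\<^sub>j)\<close> when the
  second one does, and after one turn it returns to its initial value.\<close>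

lemma same_field_sum_trans:
  fixes f :: "int^2^2 \<Rightarrow> int"
  assumes D: "is_loop_field D" and D': "is_loop_field D'" and same: "same_field D D'"
    and f: "\<And>A B. A \<in> carrier Gamma0_2 \<Longrightarrow> B \<in> carrier Gamma0_2 \<Longrightarrow> [f (A ** B) = f A + f B] (mod N)"
  shows "[(\<Sum>i=1..int (nseg D). f (trans D i)) = (\<Sum>j=1..int (nseg D'). f (trans D' j))] (mod N)"
proof -
  obtain g where
    g: "\<And>i j. segment D i \<inter> segment D' j \<noteq> {} \<Longrightarrow> g i j \<in> carrier Gamma0_2"
      "\<And>i j. segment D i \<inter> segment D' j \<noteq> {} \<Longrightarrow> g (i + int (nseg D)) (j + int (nseg D')) = g i j"
    and gD: "\<And>i j. cut D i \<in> segment D' j \<Longrightarrow> g (i + 1) j ** trans D i = g i j"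
    and gD': "\<And>i j. cut D' j \<in> segment D i \<Longrightarrow> trans D' j ** g i j = g i (j + 1)"
    using same unfolding same_field_def by metis
  have mono: "strict_mono (cut D)" "strict_mono (cut D')" using D D' by (auto intro: strict_mono_cut)
  have mem: "cut D i \<in> segment D i" "cut D i \<in> segment D (i + 1)" "cut D' i \<in> segment D' i" "cut D' i \<in> segment D' (i + 1)" for i
    using mono by (auto simp: segment_def strict_mono_less_eq)
  have tr: "trans D i \<in> carrier Gamma0_2" "trans D' i \<in> carrier Gamma0_2" for i
    using loop_field_jump(2) D D' by auto
  have stepD: "[f (g (i + 1) j) + f (trans D i) = f (g i j)] (mod N)" if "cut D i \<in> segment D' j" for i j
    using f[OF g(1)[of "i + 1" j] tr(1)[of i]] gD[OF that] mem(2)[of i] that by (auto simp: cong_sym_eq)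
  have stepD': "[f (g i (j + 1)) = f (g i j) + f (trans D' j)] (mod N)" if "cut D' j \<in> segment D i" for i j
    using f[OF tr(2)[of j] g(1)[of i j]] gD'[OF that] mem(3)[of j] that by (auto simp: add.commute)
  \<comment> \<open>The segment of \<open>D'\<close> on which segment \<open>i\<close> of
    \<open>D\<close> ends. If cuts of \<open>D\<close> and \<open>D'\<close> coincide there, the
    first index advances before the second.\<close>
  define J where "J i = (THE j. cut D' (j - 1) < cut D i \<and> cut D i \<le> cut D' j)" for i
  have J: "cut D' (J i - 1) < cut D i" "cut D i \<le> cut D' (J i)" for i
    using theI'[OF cut_cover[OF D', of "cut D i"]] unfolding J_def by auto
  have J_unique: "J i = j" if "cut D' (j - 1) < cut D i" "cut D i \<le> cut D' j" for i j
    using cut_cover[OF D', of "cut D i"] J[of i] that by blast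
  have Jmem: "cut D i \<in> segment D' (J i)" for i using J[of i] by (auto simp: segment_def)
  have J_shift: "J (i + int (nseg D)) = J i + int (nseg D')" for i
    using J[of i] cut_periodic[OF D, of i 1] cut_periodic[OF D', of "J i" 1] cut_periodic[OF D', of "J i - 1" 1]
    by (intro J_unique) (auto simp: algebra_simps)
  have J_le: "J i \<le> J (i + 1)" for i
  proof -
    have "cut D' (J i - 1) < cut D' (J (i + 1))"
      using J[of i] J[of "i + 1"] strict_monoD[OF mono(1), of i "i + 1"] by linarith
    then show ?thesis using strict_mono_less[OF mono(2)] by force
  qed
  \<comment> \<open>Between two consecutive cuts of \<open>D\<close> only the second index
    moves.\<close>
  have inner: "[f (g (i + 1) (J i + int m)) = f (g (i + 1) (J i)) + (\<Sum>j\<in>{J i..<J i + int m}. f (trans D' j))] (mod N)"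
    if "J i + int m \<le> J (i + 1)" for i m
    using that
  proof (induction m)
    case (Suc m)
    let ?j = "J i + int m"
    have "cut D i \<le> cut D' ?j" using J(2)[of i] strict_mono_less_eq[OF mono(2), of "J i" ?j] by simp
    moreover have "cut D' ?j \<le> cut D (i + 1)"
      using J(1)[of "i + 1"] strict_mono_less_eq[OF mono(2), of ?j "J (i + 1) - 1"] Suc.prems by simp
    ultimately have "cut D' ?j \<in> segment D (i + 1)" by (simp add: segment_def)
    from stepD'[OF this] have "[f (g (i + 1) (?j + 1)) = f (g (i + 1) ?j) + f (trans D' ?j)] (mod N)" .
    also have "[f (g (i + 1) ?j) + f (trans D' ?j) =
        f (g (i + 1) (J i)) + (\<Sum>j\<in>{J i..<?j}. f (trans D' j)) + f (trans D' ?j)] (mod N)"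
      using Suc by (intro cong_add) auto
    also have "{J i..<J i + int (Suc m)} = insert ?j {J i..<?j}" by auto
    then have "f (g (i + 1) (J i)) + (\<Sum>j\<in>{J i..<?j}. f (trans D' j)) + f (trans D' ?j) =
        f (g (i + 1) (J i)) + (\<Sum>j\<in>{J i..<J i + int (Suc m)}. f (trans D' j))" by simp
    finally show ?case by (simp add: algebra_simps)
  qed simp
  \<comment> \<open>The walk from \<open>(1, J 1)\<close> to \<open>(1 + k, J (1 + k))\<close>: each
    stage crosses one cut of \<open>D\<close> and then the cuts of \<open>D'\<close> before the next
    one.\<close>
  have "J 1 \<le> J (1 + int k) \<and> [f (g (1 + int k) (J (1 + int k))) + (\<Sum>i=1..int k. f (trans D i)) =
      f (g 1 (J 1)) + (\<Sum>j\<in>{J 1..<J (1 + int k)}. f (trans D' j))] (mod N)" for k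
  proof (induction k)
    case (Suc k)
    let ?i = "1 + int k"
    define m where "m = nat (J (?i + 1) - J ?i)"
    have m: "J ?i + int m = J (?i + 1)" using J_le[of ?i] by (simp add: m_def)
    define A B C E t T S S0 where
      "A = f (g (?i + 1) (J (?i + 1)))" and "B = f (g (?i + 1) (J ?i))" and "C = f (g ?i (J ?i))" and
      "E = f (g 1 (J 1))" and "t = f (trans D ?i)" and "T = (\<Sum>i=1..int k. f (trans D i))" and
      "S = (\<Sum>j\<in>{J ?i..<J (?i + 1)}. f (trans D' j))" and "S0 = (\<Sum>j\<in>{J 1..<J ?i}. f (trans D' j))"
    have "N dvd A - (B + S)" "N dvd B + t - C" "N dvd C + T - (E + S0)"
      using inner[of ?i m] m stepD[OF Jmem[of ?i]] Suc
      unfolding cong_iff_dvd_diff A_def B_def C_def E_def t_def T_def S_def S0_def by auto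
    then have "N dvd (A - (B + S)) + (B + t - C) + (C + T - (E + S0))"
      by (intro dvd_add)
    then have "[A + (T + t) = E + (S0 + S)] (mod N)"
      unfolding cong_iff_dvd_diff by (simp add: algebra_simps)
    moreover have "{J 1..<J (?i + 1)} = {J 1..<J ?i} \<union> {J ?i..<J (?i + 1)}" using Suc J_le[of ?i] by auto
    then have "(\<Sum>j\<in>{J 1..<J (?i + 1)}. f (trans D' j)) = S0 + S"
      by (simp add: sum.union_disjoint S_def S0_def)
    moreover have "(\<Sum>i=1..int (Suc k). f (trans D i)) = T + t"
      unfolding sum_int_Suc T_def t_def by simp
    ultimately show ?case using Suc J_le[of ?i] by (simp add: A_def E_def add.commute)
  qed simp
  from this[of "nseg D"] have *: "[f (g (1 + int (nseg D)) (J (1 + int (nseg D)))) + (\<Sum>i=1..int (nseg D). f (trans D i)) =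
      f (g 1 (J 1)) + (\<Sum>j\<in>{J 1..<J (1 + int (nseg D))}. f (trans D' j))] (mod N)" by blast
  \<comment> \<open>After one turn each index has moved by its own period, so the comparison matrix
    is the initial one and cancels.\<close>
  have "g (1 + int (nseg D)) (J (1 + int (nseg D))) = g 1 (J 1)"
    unfolding J_shift using mem(1)[of 1] Jmem[of 1] by (intro g(2)) blast
  moreover have "trans D' (j + int (nseg D')) = trans D' j" for j
    using D' unfolding is_loop_field_def by blast
  then have "(\<Sum>j\<in>{J 1..<J (1 + int (nseg D))}. f (trans D' j)) = (\<Sum>j=1..int (nseg D'). f (trans D' j))"
    unfolding J_shift by (intro sum_periodic_int) simp
  ultimately show ?thesis using * by (simp add: cong_add_lcancel)
qed

lemma same_field_q_monodromy:
  assumes "is_loop_field D" "is_loop_field D'" "same_field D D'"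
  shows "qZ (monodromy D) = qZ (monodromy D')" "qZ4 (monodromy D) = qZ4 (monodromy D')"
proof -
  \<comment> \<open>Congruence modulo 0 is equality, so one walk serves both characters.\<close>
  have "[(\<Sum>i=1..int (nseg D). qZ (trans D i)) = (\<Sum>j=1..int (nseg D'). qZ (trans D' j))] (mod 0)"
    by (rule same_field_sum_trans[OF assms]) (simp add: q_mult)
  then show "qZ (monodromy D) = qZ (monodromy D')"
    unfolding monodromy_def using assms by (simp add: q_continuation)
  have "[(\<Sum>i=1..int (nseg D). qZ4 (trans D i)) = (\<Sum>j=1..int (nseg D'). qZ4 (trans D' j))] (mod 4)"
    by (rule same_field_sum_trans[OF assms]) (simp add: q_mult)
  then show "qZ4 (monodromy D) = qZ4 (monodromy D')"
    unfolding monodromy_def using assms by (simp add: q_continuation cong_minus_minus_iff flip: cong_def)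
qed

text \<open>One segment suffices: with the inverse of \<open>M\<close> as transition function, the
  straight path from its image of \<open>\<i>\<close> to \<open>\<i>\<close> stays in the convex
  half-plane.\<close>

lemma exists_loop_field:
  assumes M: "M \<in> carrier Gamma0_2"
  shows "\<exists>D. is_loop_field D \<and> monodromy D = M"
proof -
  define N where "N = inv\<^bsub>Gamma0_2\<^esub> M"
  have N: "N \<in> carrier Gamma0_2" unfolding N_def using M by simp
  define p where "p = moebius_act N \<i>"
  have p: "Im p > 0" unfolding p_def using det_Gamma0_2[OF N] by (intro Im_moebius_act_pos) auto
  define \<tau> where "\<tau> i s = p + of_real (s - of_int (i - 1)) * (\<i> - p)" for i :: int and s :: real
  define D where "D = \<lparr>nseg = 1, cut = of_int, fld = \<tau>, trans = \<lambda>_. N\<rparr>"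
  have D_simps: "nseg D = 1" "cut D = of_int" "fld D = \<tau>" "trans D = (\<lambda>_. N)"
    by (simp_all add: D_def)
  have "Im (\<tau> i s) > 0" if "s \<in> segment D i" for i s
  proof -
    define t where "t = s - of_int (i - 1)"
    have t: "0 \<le> t" "t \<le> 1" using that by (auto simp: t_def segment_def D_simps)
    have "Im (\<tau> i s) = (1 - t) * Im p + t" unfolding \<tau>_def t_def[symmetric] by (simp add: algebra_simps)
    moreover have "(1 - t) * Im p + t > 0"
      using t p by (cases "t = 0") (auto intro: add_nonneg_pos)
    ultimately show ?thesis by simp
  qed
  moreover have "\<tau> i piecewise_C1_differentiable_on segment D i" for i
  proof (rule C1_differentiable_imp_piecewise)
    show "\<tau> i C1_differentiable_on segment D i"
      unfolding C1_differentiable_on_def \<tau>_def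
      by (intro exI[of _ "\<lambda>_. \<i> - p"]) (auto intro!: derivative_eq_intros)
  qed
  moreover have "\<tau> (i + 1) (of_int i) = moebius_act N (\<tau> i (of_int i))" for i
    by (simp add: \<tau>_def p_def)
  ultimately have "is_loop_field D"
    unfolding is_loop_field_def using N by (auto simp: D_simps) (auto simp: \<tau>_def)
  moreover have "monodromy D = M"
    unfolding monodromy_def by (simp add: D_simps N_def M)
  ultimately show ?thesis by blast
qed

section \<open>Global behaviour of the two one-forms\<close>

text \<open>A change of representative adds a constant to \<open>L (\<tau> y)\<close>, which the
  derivative does not see.\<close>

lemma globally_well_defined_Delta_Z:
  fixes U :: "'a::euclidean_space set"
  assumes L: "log_branch Delta_Z L" and U: "open U"
  shows "globally_well_defined L U"
  unfolding globally_well_defined_def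
proof (intro ballI allI impI)
  fix M and \<tau> :: "'a \<Rightarrow> complex" and x
  assume M: "M \<in> carrier Gamma0_2" and \<tau>: "\<tau> ` U \<subseteq> upper_half_plane \<and> \<tau> differentiable_on U" and x: "x \<in> U"
  have "\<tau> differentiable (at x)"
    using \<tau> x U at_within_open[of x U] unfolding differentiable_on_def by metis
  moreover have "L field_differentiable (at (\<tau> x))"
    using L \<tau> x holomorphic_on_imp_differentiable_at[OF _ open_halfspace_Im_gt] unfolding log_branch_def by blast
  ultimately have "(\<lambda>y. L (\<tau> y)) differentiable (at x)"
    using differentiable_chain_at[of \<tau> x L] field_differentiable_imp_differentiable unfolding o_def by blast
  then obtain f' where f': "((\<lambda>y. L (\<tau> y)) has_derivative f') (at x)"
    unfolding differentiable_def by blast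
  then have "((\<lambda>y. L (\<tau> y) + 2 * of_real pi * \<i> * of_int (qZ M)) has_derivative f') (at x)"
    by (auto intro!: derivative_eq_intros)
  then have "((\<lambda>y. L (moebius_act M (\<tau> y))) has_derivative f') (at x)"
    by (rule has_derivative_transform_within_open[OF _ U x])
      (use \<tau> log_branch_Delta_Z_moebius[OF L M] in auto)
  from frechet_derivative_at[OF this] frechet_derivative_at[OF f']
  show "dlog L (\<lambda>y. moebius_act M (\<tau> y)) x = dlog L \<tau> x"
    unfolding dlog_def by (rule trans[OF sym])
qed

text \<open>The witness is a field of constant height 1 that varies along a single basis vector.
  Moving it by \<open>X_mat\<close> changes the one-form by the differential of
  \<open>4 * Ln (2 * \<tau> - 1)\<close>, which is nonzero along that vector.\<close>

lemma not_globally_well_defined_Delta_Z4: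
  fixes U :: "'a::euclidean_space set"
  assumes L: "log_branch Delta_Z4 L" and U: "open U" "U \<noteq> {}"
    and LX: "\<And>\<tau>. Im \<tau> > 0 \<Longrightarrow> L (moebius_act X_mat \<tau>) = L \<tau> + 2 * of_real pi * \<i> - 4 * Ln (2 * \<tau> - 1)"
  shows "\<not> globally_well_defined L U"
proof
  assume gwd: "globally_well_defined L U"
  obtain x where x: "x \<in> U" using U by blast
  obtain b :: 'a where b: "b \<in> Basis" using nonempty_Basis by blast
  define \<tau> where "\<tau> y = \<i> + complex_of_real (y \<bullet> b)" for y :: 'a
  have Im: "Im (\<tau> y) = 1" for y by (simp add: \<tau>_def)
  have d\<tau>: "(\<tau> has_derivative (\<lambda>h. complex_of_real (h \<bullet> b))) (at y)" for y
    unfolding \<tau>_def by (auto intro!: derivative_eq_intros)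
  then have diff: "\<tau> differentiable_on U"
    by (auto simp: differentiable_on_def differentiable_def intro: has_derivative_at_withinI)
  have "\<tau> ` U \<subseteq> upper_half_plane" by (auto simp: Im)
  then have eq: "dlog L (\<lambda>y. moebius_act X_mat (\<tau> y)) x = dlog L \<tau> x"
    using gwd x diff X_mat_in_Gamma0_2 unfolding globally_well_defined_def by blast
  have "L field_differentiable (at (\<tau> x))"
    using L Im[of x] holomorphic_on_imp_differentiable_at[OF _ open_halfspace_Im_gt, of L 0 "\<tau> x"] unfolding log_branch_def by simp
  then obtain d where "(L has_field_derivative d) (at (\<tau> x))" unfolding field_differentiable_def by blast
  then have dL: "((\<lambda>y. L (\<tau> y)) has_derivative (\<lambda>h. d * complex_of_real (h \<bullet> b))) (at x)"
    unfolding has_field_derivative_def by (rule has_derivative_compose[OF d\<tau>])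
  define c where "c = 8 / (2 * \<tau> x - 1)"
  have im: "Im (2 * \<tau> x - 1) = 2" using Im[of x] by simp
  then have nz: "2 * \<tau> x - 1 \<noteq> 0" by force
  have "2 * \<tau> x - 1 \<notin> \<real>\<^sub>\<le>\<^sub>0" using im by (auto simp: complex_nonpos_Reals_iff)
  then have "((\<lambda>z. 4 * Ln (2 * z - 1)) has_field_derivative c) (at (\<tau> x))"
    using nz unfolding c_def by (auto intro!: derivative_eq_intros simp: divide_inverse)
  then have "((\<lambda>y. 4 * Ln (2 * \<tau> y - 1)) has_derivative (\<lambda>h. c * complex_of_real (h \<bullet> b))) (at x)"
    unfolding has_field_derivative_def by (rule has_derivative_compose[OF d\<tau>])
  from has_derivative_diff[OF has_derivative_add[OF dL has_derivative_const] this]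
  have "((\<lambda>y. L (moebius_act X_mat (\<tau> y))) has_derivative
      (\<lambda>h. d * complex_of_real (h \<bullet> b) + 0 - c * complex_of_real (h \<bullet> b))) (at x)"
    using LX Im by simp
  from frechet_derivative_at[OF this] frechet_derivative_at[OF dL] eq
  have "(\<lambda>h. d * complex_of_real (h \<bullet> b) + 0 - c * complex_of_real (h \<bullet> b)) = (\<lambda>h. d * complex_of_real (h \<bullet> b))"
    unfolding dlog_def by (elim trans) simp
  from fun_cong[OF this, of b] have "c * complex_of_real (b \<bullet> b) = 0" by simp
  then show False using b nz by (simp add: c_def inner_same_Basis)
qed


subsection \<open>Abelianization\<close>

abbreviation (input) charge_group :: "(int \<times> int) monoid" where
  "charge_group \<equiv> integer_group \<times>\<times> integer_mod_group 4"

lemma q_hom: "qZ \<in> hom Gamma0_2 integer_group" "qZ4 \<in> hom Gamma0_2 (integer_mod_group 4)"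
  "(\<lambda>M. (qZ M, qZ4 M)) \<in> hom Gamma0_2 charge_group"
  using q_mult qZ4_range by (auto simp: hom_def carrier_integer_mod_group)

lemma X_mat_power_4: "X_mat ** (X_mat ** (X_mat ** X_mat)) = mat 1"
  by (simp add: X_mat_eq_mat2 mat_1_eq_mat2)

text \<open>The map \<open>h\<close> sends \<open>(a, b)\<close> to \<open>t^a x^b\<close>, where
  \<open>t\<close> and \<open>x\<close> are the images of the generators. It respects addition
  modulo 4 because \<open>X_mat\<close> has fourth power 1, and it agrees with \<open>f\<close> by
  induction over the generators.\<close>

lemma Gamma0_2_hom_factors:
  fixes A :: "('b, 'm) monoid_scheme"
  assumes A: "comm_group A" and f: "f \<in> hom Gamma0_2 A"
  shows "\<exists>h \<in> hom charge_group A. \<forall>M\<in>carrier Gamma0_2. f M = h (qZ M, qZ4 M)"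
proof -
  interpret A: comm_group A by (rule A)
  interpret f: group_hom Gamma0_2 A f
    using f group_Gamma0_2 A.group_axioms by (simp add: group_hom_def group_hom_axioms_def)
  define t x where "t = f T_mat" and "x = f X_mat"
  have tx: "t \<in> carrier A" "x \<in> carrier A"
    unfolding t_def x_def using f T_mat_in_Gamma0_2 X_mat_in_Gamma0_2 by (auto simp: hom_def)
  have mult: "f (B ** C) = f B \<otimes>\<^bsub>A\<^esub> f C" if "B \<in> carrier Gamma0_2" "C \<in> carrier Gamma0_2" for B C
    using f that unfolding hom_def by simp
  have "f (mat 1) = \<one>\<^bsub>A\<^esub>" using f.hom_one by simp
  then have x4: "x \<otimes>\<^bsub>A\<^esub> (x \<otimes>\<^bsub>A\<^esub> (x \<otimes>\<^bsub>A\<^esub> x)) = \<one>\<^bsub>A\<^esub>"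
    using X_mat_in_Gamma0_2 Gamma0_2.m_closed unfolding x_def X_mat_power_4[symmetric] by (simp add: mult)
  have "x [^]\<^bsub>A\<^esub> (4::int) = \<one>\<^bsub>A\<^esub>"
  proof -
    have "x [^]\<^bsub>A\<^esub> (1 + (1 + (1 + 1))::int) = \<one>\<^bsub>A\<^esub>"
      using x4 tx unfolding A.int_pow_mult[OF tx(2)] by simp
    then show ?thesis by simp
  qed
  then have x_mod: "x [^]\<^bsub>A\<^esub> (b mod 4) = x [^]\<^bsub>A\<^esub> b" for b :: int
    using A.int_pow_mult[OF tx(2), of "4 * (b div 4)" "b mod 4"] A.int_pow_pow[OF tx(2), of 4 "b div 4"] tx by simp
  define h where "h p = t [^]\<^bsub>A\<^esub> fst p \<otimes>\<^bsub>A\<^esub> x [^]\<^bsub>A\<^esub> snd p" for p :: "int \<times> int"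
  have h: "h \<in> hom charge_group A"
  proof (rule homI)
    fix p p' assume "p \<in> carrier charge_group" "p' \<in> carrier charge_group"
    show "h (p \<otimes>\<^bsub>charge_group\<^esub> p') = h p \<otimes>\<^bsub>A\<^esub> h p'"
      using tx by (cases p; cases p') (simp add: h_def x_mod A.int_pow_mult A.m_ac)
  qed (use tx in \<open>auto simp: h_def\<close>)
  have step: "f (B ** C) = h (qZ (B ** C), qZ4 (B ** C))"
    if "B \<in> carrier Gamma0_2" "C \<in> carrier Gamma0_2" "f B = h (qZ B, qZ4 B)" "f C = h (qZ C, qZ4 C)" for B C
  proof -
    have "h (qZ (B ** C), qZ4 (B ** C)) = h ((qZ B, qZ4 B) \<otimes>\<^bsub>charge_group\<^esub> (qZ C, qZ4 C))"
      using that by (simp add: q_mult)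
    also have "\<dots> = h (qZ B, qZ4 B) \<otimes>\<^bsub>A\<^esub> h (qZ C, qZ4 C)"
      using that qZ4_range by (intro hom_mult[OF h]) (auto simp: carrier_integer_mod_group)
    finally show ?thesis using that mult by simp
  qed
  have fT: "f T_mat = h (qZ T_mat, qZ4 T_mat)" and fX: "f X_mat = h (qZ X_mat, qZ4 X_mat)"
    using tx by (simp_all add: h_def q_generators t_def[symmetric] x_def[symmetric])
  have fTi: "f (inv\<^bsub>Gamma0_2\<^esub> T_mat) = h (qZ (inv\<^bsub>Gamma0_2\<^esub> T_mat), qZ4 (inv\<^bsub>Gamma0_2\<^esub> T_mat))"
    using tx T_mat_in_Gamma0_2 f.hom_inv[of T_mat]
    by (simp add: h_def q_inv q_generators t_def[symmetric] A.int_pow_neg)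
  have "f M = h (qZ M, qZ4 M)" if "M \<in> carrier Gamma0_2" for M
    using that
  proof (induction rule: Gamma0_2_induct)
    case one
    then show ?case using f.hom_one by (simp add: q_generators h_def)
  qed (use step fT fTi fX T_mat_in_Gamma0_2 X_mat_in_Gamma0_2 in auto)
  with h show ?thesis by blast
qed

lemma comm_group_charge_group: "comm_group charge_group"
proof (rule group.group_comm_groupI)
  show "group charge_group" by (intro DirProd_group group_integer_group group_integer_mod_group)
qed (auto simp: add.commute)

text \<open>For the inclusion of the kernel, the factorisation is applied to the quotient map by the
  derived subgroup: where both characters vanish, the coset is trivial.\<close>

lemma kernel_q: "kernel Gamma0_2 charge_group (\<lambda>M. (qZ M, qZ4 M)) = derived Gamma0_2 (carrier Gamma0_2)"
proof
  interpret C: comm_group charge_group by (rule comm_group_charge_group)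
  interpret q: group_hom Gamma0_2 charge_group "\<lambda>M. (qZ M, qZ4 M)"
    using q_hom(3) group_Gamma0_2 C.group_axioms by (simp add: group_hom_def group_hom_axioms_def)
  let ?K = "kernel Gamma0_2 charge_group (\<lambda>M. (qZ M, qZ4 M))"
  show "derived Gamma0_2 (carrier Gamma0_2) \<subseteq> ?K"
    unfolding derived_def
  proof (rule group.generate_subgroup_incl[OF group_Gamma0_2 _ q.subgroup_kernel])
    show "derived_set Gamma0_2 (carrier Gamma0_2) \<subseteq> ?K"
      using Gamma0_2.m_closed Gamma0_2.inv_closed
      by (auto simp: kernel_def q_mult q_inv mod_simps)
  qed
  let ?H = "derived Gamma0_2 (carrier Gamma0_2)"
  interpret H: normal ?H Gamma0_2 by (rule group.derived_self_is_normal[OF group_Gamma0_2])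
  obtain h where h: "\<And>M. M \<in> carrier Gamma0_2 \<Longrightarrow> ?H #>\<^bsub>Gamma0_2\<^esub> M = h (qZ M, qZ4 M)"
    using Gamma0_2_hom_factors[OF group.derived_quot_is_comm_group[OF group_Gamma0_2] H.r_coset_hom_Mod] by blast
  show "?K \<subseteq> ?H"
  proof
    fix M assume "M \<in> ?K"
    then have M: "M \<in> carrier Gamma0_2" "qZ M = 0" "qZ4 M = 0" by (auto simp: kernel_def)
    then have "?H #>\<^bsub>Gamma0_2\<^esub> M = ?H #>\<^bsub>Gamma0_2\<^esub> \<one>\<^bsub>Gamma0_2\<^esub>"
      using h[of M] h[of "\<one>\<^bsub>Gamma0_2\<^esub>"] Gamma0_2.one_closed by (simp add: q_generators)
    also have "\<dots> = ?H" by (rule group.coset_mult_one[OF group_Gamma0_2 H.subset])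
    finally show "M \<in> ?H" by (rule group.coset_join1[OF group_Gamma0_2 _ M(1) H.subgroup_axioms])
  qed
qed

lemma q_surj: "(\<lambda>M. (qZ M, qZ4 M)) ` carrier Gamma0_2 = carrier charge_group"
proof
  show "(\<lambda>M. (qZ M, qZ4 M)) ` carrier Gamma0_2 \<subseteq> carrier charge_group"
    using q_hom(3) by (auto simp: hom_def)
  have Tp: "\<exists>M\<in>carrier Gamma0_2. qZ M = a \<and> qZ4 M = 0" for a
  proof (induction a rule: int_induct[where k = 0])
    case base
    show ?case using q_generators Gamma0_2.one_closed by (intro bexI[of _ "mat 1"]) auto
  next
    case (step1 a)
    then obtain M where "M \<in> carrier Gamma0_2" "qZ M = a" "qZ4 M = 0" by blast
    then show ?case using T_mat_in_Gamma0_2 Gamma0_2.m_closed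
      by (intro bexI[of _ "M ** T_mat"]) (auto simp: q_mult q_generators)
  next
    case (step2 a)
    then obtain M where "M \<in> carrier Gamma0_2" "qZ M = a" "qZ4 M = 0" by blast
    then show ?case using T_mat_in_Gamma0_2 Gamma0_2.m_closed
      by (intro bexI[of _ "M ** inv\<^bsub>Gamma0_2\<^esub> T_mat"]) (auto simp: q_mult q_inv q_generators)
  qed
  \<comment> \<open>Below 4, adding 1 does not wrap around, so powers of \<open>X_mat\<close> reach
    every residue.\<close>
  have *: "\<exists>M\<in>carrier Gamma0_2. qZ M = a \<and> qZ4 M = int b" if "b < 4" for a and b :: nat
    using that
  proof (induction b)
    case (Suc b)
    then obtain M where "M \<in> carrier Gamma0_2" "qZ M = a" "qZ4 M = int b" by auto
    then show ?case using X_mat_in_Gamma0_2 Gamma0_2.m_closed Suc.prems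
      by (intro bexI[of _ "M ** X_mat"]) (auto simp: q_mult q_generators)
  qed (use Tp in simp)
  have "(a, b) \<in> (\<lambda>M. (qZ M, qZ4 M)) ` carrier Gamma0_2" if "b \<in> {0..<4}" for a b
  proof -
    have "nat b < 4" using that by auto
    then obtain M where "M \<in> carrier Gamma0_2" "qZ M = a" "qZ4 M = int (nat b)"
      using * by blast
    then show ?thesis using that by (intro image_eqI[of _ _ M]) auto
  qed
  then show "carrier charge_group \<subseteq> (\<lambda>M. (qZ M, qZ4 M)) ` carrier Gamma0_2"
    by (auto simp: carrier_integer_mod_group)
qed

text \<open>First isomorphism theorem, with the kernel identified as the derived subgroup.\<close>

lemma abelianization_iso:
  "(\<lambda>C. the_elem ((\<lambda>M. (qZ M, qZ4 M)) ` C)) \<in> iso (abelianization Gamma0_2) charge_group"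
proof -
  interpret q: group_hom Gamma0_2 charge_group "\<lambda>M. (qZ M, qZ4 M)"
    using q_hom(3) group_Gamma0_2 comm_group_charge_group
    by (simp add: group_hom_def group_hom_axioms_def comm_group_def)
  show ?thesis
    using q.FactGroup_iso_set[OF q_surj] unfolding kernel_q abelianization_def .
qed

lemma log_branch_Delta_Z4_generators:
  assumes L: "log_branch Delta_Z4 L" and \<tau>: "Im \<tau> > 0"
  shows "L (moebius_act T_mat \<tau>) = L \<tau>"
    and "L (moebius_act X_mat \<tau>) = L \<tau> + 2 * of_real pi * \<i> - 4 * Ln (2 * \<tau> - 1)"
proof -
  obtain k where k: "\<And>\<tau>. Im \<tau> > 0 \<Longrightarrow> L \<tau> = log_Delta_Z4 \<tau> + 2 * of_real pi * \<i> * of_int k"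
    using log_branch_unique[OF L log_branch_log_Delta_Z4] by blast
  have "Im (moebius_act T_mat \<tau>) > 0" "Im (moebius_act X_mat \<tau>) > 0"
    using Im_moebius_act_pos[OF det_Gamma0_2 \<tau>] T_mat_in_Gamma0_2 X_mat_in_Gamma0_2 by auto
  then show "L (moebius_act T_mat \<tau>) = L \<tau>"
    "L (moebius_act X_mat \<tau>) = L \<tau> + 2 * of_real pi * \<i> - 4 * Ln (2 * \<tau> - 1)"
    unfolding k[OF \<tau>] using log_Delta_Z4_X[OF \<tau>]
    by (simp_all add: k moebius_act_T moebius_act_X log_Delta_Z4_plus_1)
qed

theorem mainTheorem2:
  shows
   "(\<exists>L. log_branch Delta_Z L) \<and> (\<exists>L. log_branch Delta_Z4 L) \<and>
    \<comment> \<open>(i)\<close>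
    (\<forall>L. log_branch Delta_Z L \<longrightarrow>
       (\<forall>\<tau>\<in>upper_half_plane.
          L (moebius_act T_mat \<tau>) = L \<tau> + 2 * of_real pi * \<i> \<and>
          L (moebius_act X_mat \<tau>) = L \<tau>) \<and>
       (\<forall>U :: 'a::euclidean_space set. open U \<longrightarrow> globally_well_defined L U)) \<and>
    (\<forall>L L' D D'. log_branch Delta_Z L \<and> log_branch Delta_Z L' \<and>
       is_loop_field D \<and> is_loop_field D' \<and> same_field D D' \<longrightarrow>
       charge_Z L D = charge_Z L' D') \<and>
    \<comment> \<open>(ii)\<close>
    (\<forall>L. log_branch Delta_Z4 L \<longrightarrow>
       (\<forall>\<tau>\<in>upper_half_plane.
          L (moebius_act T_mat \<tau>) = L \<tau> \<and>
          L (moebius_act X_mat \<tau>) = L \<tau> + 2 * of_real pi * \<i> - 4 * Ln (2 * \<tau> - 1)) \<and>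
       (\<forall>U :: 'a set. open U \<and> U \<noteq> {} \<longrightarrow> \<not> globally_well_defined L U)) \<and>
    (\<forall>L L' D D' \<phi> \<phi>'. log_branch Delta_Z4 L \<and> log_branch Delta_Z4 L' \<and>
       is_loop_field D \<and> is_loop_field D' \<and> same_field D D' \<and>
       log_choice D \<phi> \<and> log_choice D' \<phi>' \<longrightarrow>
       (\<exists>k::int. charge_Z4_with L \<phi> D - charge_Z4_with L' \<phi>' D' = 4 * of_int k)) \<and>
    \<comment> \<open>(iii)\<close>
    (\<forall>M\<in>carrier Gamma0_2. \<exists>D. is_loop_field D \<and> monodromy D = M) \<and>
    (\<exists>QZ QZ4.
       QZ \<in> hom Gamma0_2 integer_group \<and>
       QZ4 \<in> hom Gamma0_2 (integer_mod_group 4) \<and>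
       (\<forall>L D. log_branch Delta_Z L \<and> is_loop_field D \<longrightarrow>
          charge_Z L D = of_int (QZ (monodromy D))) \<and>
       (\<forall>L D. log_branch Delta_Z4 L \<and> is_loop_field D \<longrightarrow>
          (\<exists>k::int. charge_Z4 L D = of_int k \<and> k mod 4 = QZ4 (monodromy D))) \<and>
       QZ T_mat = 1 \<and> QZ X_mat = 0 \<and> QZ4 T_mat = 0 \<and> QZ4 X_mat = 1 \<and>
       (\<lambda>C. the_elem ((\<lambda>M. (QZ M, QZ4 M)) ` C))
         \<in> iso (abelianization Gamma0_2) (integer_group \<times>\<times> integer_mod_group 4) \<and>
       (\<forall>(A :: 'b monoid) f. comm_group A \<and> f \<in> hom Gamma0_2 A \<longrightarrow>
          (\<exists>h \<in> hom (integer_group \<times>\<times> integer_mod_group 4) A.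
             \<forall>M\<in>carrier Gamma0_2. f M = h (QZ M, QZ4 M))))"
proof (intro conjI allI ballI impI)
  show "\<exists>L. log_branch Delta_Z L" using log_branch_log_Delta_Z by blast
  show "\<exists>L. log_branch Delta_Z4 L" using log_branch_log_Delta_Z4 by blast
next
  fix L \<tau> assume L: "log_branch Delta_Z L" and \<tau>: "\<tau> \<in> upper_half_plane"
  show "L (moebius_act T_mat \<tau>) = L \<tau> + 2 * of_real pi * \<i>" "L (moebius_act X_mat \<tau>) = L \<tau>"
    using log_branch_Delta_Z_moebius[OF L T_mat_in_Gamma0_2, of \<tau>]
      log_branch_Delta_Z_moebius[OF L X_mat_in_Gamma0_2, of \<tau>] \<tau> by (simp_all add: q_generators)
next
  fix L and U :: "'a set" assume "log_branch Delta_Z L" "open U"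
  then show "globally_well_defined L U" by (rule globally_well_defined_Delta_Z)
next
  fix L L' D D'
  assume "log_branch Delta_Z L \<and> log_branch Delta_Z L' \<and> is_loop_field D \<and> is_loop_field D' \<and> same_field D D'"
  then show "charge_Z L D = charge_Z L' D'"
    using same_field_q_monodromy(1)[of D D'] by (simp add: charge_Z_eq)
next
  fix L \<tau> assume "log_branch Delta_Z4 L" "\<tau> \<in> upper_half_plane"
  then show "L (moebius_act T_mat \<tau>) = L \<tau>"
    "L (moebius_act X_mat \<tau>) = L \<tau> + 2 * of_real pi * \<i> - 4 * Ln (2 * \<tau> - 1)"
    using log_branch_Delta_Z4_generators by auto
next
  fix L and U :: "'a set" assume "log_branch Delta_Z4 L" "open U \<and> U \<noteq> {}"
  then show "\<not> globally_well_defined L U"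
    using not_globally_well_defined_Delta_Z4 log_branch_Delta_Z4_generators(2) by blast
next
  fix L L' D D' \<phi> \<phi>'
  assume *: "log_branch Delta_Z4 L \<and> log_branch Delta_Z4 L' \<and> is_loop_field D \<and> is_loop_field D' \<and> same_field D D' \<and>
       log_choice D \<phi> \<and> log_choice D' \<phi>'"
  obtain k where k: "charge_Z4_with L \<phi> D = of_int k" "k mod 4 = qZ4 (monodromy D)"
    using * charge_Z4_with_eq by blast
  obtain k' where k': "charge_Z4_with L' \<phi>' D' = of_int k'" "k' mod 4 = qZ4 (monodromy D')"
    using * charge_Z4_with_eq by blast
  \<comment> \<open>The residue depends only on the monodromy, and there only through a character
    that is the same for both descriptions.\<close>
  have "k mod 4 = k' mod 4" using k k' same_field_q_monodromy(2) * by metis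
  then obtain l where "k - k' = 4 * l" by (metis dvdE mod_eq_dvd_iff)
  then have "complex_of_int (k - k') = 4 * of_int l" by simp
  then show "\<exists>k::int. charge_Z4_with L \<phi> D - charge_Z4_with L' \<phi>' D' = 4 * of_int k"
    using k k' by auto
next
  fix M assume "M \<in> carrier Gamma0_2"
  then show "\<exists>D. is_loop_field D \<and> monodromy D = M" by (rule exists_loop_field)
next
  have Z4: "\<exists>k::int. charge_Z4 L D = of_int k \<and> k mod 4 = qZ4 (monodromy D)"
    if "log_branch Delta_Z4 L" "is_loop_field D" for L D
    unfolding charge_Z4_def using that by (intro charge_Z4_with_eq log_choice_F)
  show "\<exists>QZ QZ4.
       QZ \<in> hom Gamma0_2 integer_group \<and>
       QZ4 \<in> hom Gamma0_2 (integer_mod_group 4) \<and>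
       (\<forall>L D. log_branch Delta_Z L \<and> is_loop_field D \<longrightarrow>
          charge_Z L D = of_int (QZ (monodromy D))) \<and>
       (\<forall>L D. log_branch Delta_Z4 L \<and> is_loop_field D \<longrightarrow>
          (\<exists>k::int. charge_Z4 L D = of_int k \<and> k mod 4 = QZ4 (monodromy D))) \<and>
       QZ T_mat = 1 \<and> QZ X_mat = 0 \<and> QZ4 T_mat = 0 \<and> QZ4 X_mat = 1 \<and>
       (\<lambda>C. the_elem ((\<lambda>M. (QZ M, QZ4 M)) ` C))
         \<in> iso (abelianization Gamma0_2) (integer_group \<times>\<times> integer_mod_group 4) \<and>
       (\<forall>(A :: 'b monoid) f. comm_group A \<and> f \<in> hom Gamma0_2 A \<longrightarrow>
          (\<exists>h \<in> hom (integer_group \<times>\<times> integer_mod_group 4) A.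
             \<forall>M\<in>carrier Gamma0_2. f M = h (QZ M, QZ4 M)))"
    using q_hom(1,2) charge_Z_eq Z4 q_generators abelianization_iso Gamma0_2_hom_factors
    by (intro exI[of _ qZ] exI[of _ qZ4] conjI allI impI) blast+
qed

end
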